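(* Let $k\ge1$, $\boldsymbol{\alpha}=(\alpha_1,\dots,\alpha_k)\in(0,+\infty)^k$, $\beta\in(0,+\infty)$. Let $\mathbf{X}_n=(X_{1n},\dots,X_{kn})$, $n\in[N]$, be a random sample from the Multivariate Gamma distribution $\mathcal{MG}_k(\boldsymbol{\alpha},\beta)$ and $\mathbf{Z}_n=(Z_{1n},\dots,Z_{kn}):=\Delta\mathbf{X}_n$, $n\in[N]$. The Moment Estimator $$\tilde\beta=\frac1k\sum_{j=1}^k\frac{\overline{Z_j^2}-\overline{Z_j}^2}{\overline{Z_j}},\qquad \tilde\alpha_i=\frac{\overline{Z_i}}{\tilde\beta},\quad i\in[k],$$ is a moment-type estimator of $(\boldsymbol{\alpha},\beta)$ with functions $$h(\mathbf{x})=(z_1,\dots,z_k,z_1^2,\dots,z_k^2),\qquad g_i(\mathbf{y})=\frac{y_i}{g_{k+1}(\mathbf{y})},\ i\in[k],\qquad g_{k+1}(\mathbf{y})=\frac1k\sum_{j=1}^k\frac{y_{k+j}-y_j^2}{y_j},$$ where $\mathbf{z}=(z_1,\dots,z_k):=\Delta\mathbf{x}$. Its asymptotic variance-covariance matrix is $\mathbf{G}\mathbf{V}\mathbf{G}^\top$, where $\mathbf{V}=v_h(\boldsymbol{\alpha},\beta)$ is the $2k\times2k$ variance-covariance matrix of $h(\mathbf{X})$, $\mathbf{X}\sim\mathcal{MG}_k(\boldsymbol{\alpha},\beta)$, and $\mathbf{G}$ is the $(k+1)\times2k$ block matrix $$\mathbf{G}=\begin{bmatrix}\mathbf{G}_{11}&\mathbf{G}_{12}\\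 \mathbf{G}_{21}&\mathbf{G}_{22}\end{bmatrix}$$ with $\mathbf{G}_{11},\mathbf{G}_{12}$ of size $k\times k$ and $\mathbf{G}_{21},\mathbf{G}_{22}$ of size $1\times k$ such that, for $i,j\in[k]$, $$(\mathbf{G}_{11})_{ij}=\frac{\alpha_i}{k\beta}\left(2+\frac1{\alpha_j}\right)+\frac1\beta\mathbb{I}_{\{i=j\}},\qquad(\mathbf{G}_{12})_{ij}=-\frac{\alpha_i}{k\alpha_j\beta^2},$$ $$(\mathbf{G}_{21})_j=-\frac1k\left(2+\frac1{\alpha_j}\right),\qquad(\mathbf{G}_{22})_j=\frac1{k\alpha_j\beta}.$$
   Context: Notation: $[k]=\{1,\dots,k\}$; $\mathbb{I}$ is the indicator; a random sample is an i.i.d. sample; $\overline{h(\mathbf{X})}:=\frac1N\sum_{n=1}^N h(\mathbf{X}_n)$, so $\overline{Z_j}=\frac1N\sum_n Z_{jn}$ and $\overline{Z_j^2}=\frac1N\sum_n Z_{jn}^2$. $\Delta\mathbf{x}:=(x_1,x_2-x_1,\dots,x_k-x_{k-1})$. $e_h(\boldsymbol{\theta})=\mathbb{E}_{\boldsymbol{\theta}}(h(\mathbf{X}))$ and $v_h(\boldsymbol{\theta})=\mathbb{V}_{\boldsymbol{\theta}}(h(\mathbf{X}))$ (variance-covariance matrix). Multivariate Gamma distribution: $\mathbf{X}\sim\mathcal{MG}_k(\boldsymbol{\alpha},\beta)$ has Lebesgue density on $\mathbb{R}^k$ $f(\mathbf{x};\boldsymbol{\alpha},\beta)=\frac{1}{\beta^{\alpha_0}\prod_{i=1}^k\Gamma(\alpha_i)}e^{-x_k/\beta}x_1^{\alpha_1-1}\prod_{i=2}^k(x_i-x_{i-1})^{\alpha_i-1}$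 on $\{\mathbf{x}\in(0,+\infty)^k:x_1<x_2<\dots<x_k\}$, where $\alpha_0=\sum_{i=1}^k\alpha_i$. Moment-type estimator: for a parametric family with support $\mathbf{S}\subset\mathbb{R}^k$ and parameter space $\boldsymbol{\Theta}\subset\mathbb{R}^d$, let $h:\mathbf{S}\to\mathbb{R}^m$ be such that $e_h:\boldsymbol{\Theta}\to\mathbb{R}^m$ is injective, and let $g:\mathbb{R}^m\to\mathbb{R}^d$ satisfy $g|_{e_h(\boldsymbol{\Theta})}=e_h^{-1}$. The estimator $\tilde{\boldsymbol{\theta}}_N=g(\overline{h(\mathbf{X})})$ is called a moment-type estimator of $\boldsymbol{\theta}$ (with functions $h,g$); it exists as long as $\tilde{\boldsymbol{\theta}}_N\in\boldsymbol{\Theta}$. A function $g$ given by a formula is understood to be defined arbitrarily where the formula is undefined. Here $\boldsymbol{\theta}=(\boldsymbol{\alpha},\beta)$, $\boldsymbol{\Theta}=(0,+\infty)^{k+1}$. An estimator $\tilde{\boldsymbol{\theta}}_N$ that exists with probability tending to 1 as $N\to\infty$ has asymptotic variance-covariance matrix $\boldsymbol{\Sigma}$ if $\sqrt{N}(\tilde{\boldsymbol{\theta}}_N-\boldsymbol{\theta})$ converges in law, under $\boldsymbol{\theta}$, to the centered normal distribution with covariance matrix $\boldsymbol{\Sigma}$ as $N\to\infty$. *)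

theory Defs
  imports "HOL-Probability.Probability"
begin

text \<open>
  The index set \<open>[k]\<close> is an arbitrary finite well-ordered type \<open>'k\<close> (so \<open>k = CARD('k)\<close> ranges over all
  \<open>k \<ge> 1\<close>). Block vectors and matrices are indexed by sum types: \<open>real^('k + 'k)\<close> is the space of
  \<open>(y\<^sub>1, \<dots>, y\<^sub>k, y\<^sub>k\<^sub>+\<^sub>1, \<dots>, y\<^sub>2\<^sub>k)\<close>, with \<open>y\<^sub>j = y $ Inl j\<close> and \<open>y\<^sub>k\<^sub>+\<^sub>j = y $ Inr j\<close>, and
  \<open>real^('k + 1)\<close> is the space of \<open>(\<alpha>\<^sub>1, \<dots>, \<alpha>\<^sub>k, \<beta>)\<close>, with \<open>\<alpha>\<^sub>i = \<theta> $ Inl i\<close> and \<open>\<beta> = \<theta> $ Inr 1\<close>.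
\<close>

section \<open>Asymptotics of estimators\<close>

text \<open>Convergence in law; the library's \<^const>\<open>weak_conv_m\<close> is restricted to the real line.\<close>

definition weakly_converges :: "(nat \<Rightarrow> 'b::topological_space measure) \<Rightarrow> 'b measure \<Rightarrow> bool" where
  "weakly_converges \<mu>s \<mu> \<longleftrightarrow>
     (\<forall>f :: 'b \<Rightarrow> real. continuous_on UNIV f \<longrightarrow> bounded (range f) \<longrightarrow>
        (\<lambda>N. integral\<^sup>L (\<mu>s N) f) \<longlonglongrightarrow> integral\<^sup>L \<mu> f)"

text \<open>
  \<open>\<mu> = N(0, \<Sigma>)\<close>: every linear functional \<open>x \<mapsto> t \<bullet> x\<close> has law \<open>N(0, t \<bullet> \<Sigma>t)\<close>. A singular \<open>\<Sigma>\<close> is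
  allowed, and \<open>N(0, 0)\<close> is the Dirac measure at 0.
\<close>

definition centered_normal :: "real^'d^'d \<Rightarrow> (real^'d) measure \<Rightarrow> bool" where
  "centered_normal \<Sigma> \<mu> \<longleftrightarrow>
     prob_space \<mu> \<and> sets \<mu> = sets borel \<and> transpose \<Sigma> = \<Sigma> \<and>
     (\<forall>t. let v = t \<bullet> (\<Sigma> *v t) in
        (v = 0 \<and> distr \<mu> borel (\<lambda>x. t \<bullet> x) = return borel 0) \<or>
        (v > 0 \<and> distr \<mu> borel (\<lambda>x. t \<bullet> x) = density lborel (\<lambda>r. ennreal (normal_density 0 (sqrt v) r))))"

text \<open>
  \<open>T N\<close> is the estimator based on a sample of size \<open>N\<close>, as a random vector on \<open>M\<close>; it exists where
  its value lies in the parameter space \<open>\<Theta>\<close>.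
\<close>

definition has_asymptotic_covariance ::
    "'a measure \<Rightarrow> (real^'d) set \<Rightarrow> real^'d \<Rightarrow> (nat \<Rightarrow> 'a \<Rightarrow> real^'d) \<Rightarrow> real^'d^'d \<Rightarrow> bool" where
  "has_asymptotic_covariance M \<Theta> \<theta> T \<Sigma> \<longleftrightarrow>
     (\<forall>N. T N \<in> borel_measurable M) \<and>
     (\<lambda>N. measure M {\<omega> \<in> space M. T N \<omega> \<in> \<Theta>}) \<longlonglongrightarrow> 1 \<and>
     (\<exists>\<mu>. centered_normal \<Sigma> \<mu> \<and>
        weakly_converges (\<lambda>N. distr M borel (\<lambda>\<omega>. sqrt (real N) *\<^sub>R (T N \<omega> - \<theta>))) \<mu>)"

definition random_sample :: "'a measure \<Rightarrow> (nat \<Rightarrow> 'a \<Rightarrow> 'b::topological_space) \<Rightarrow> 'b measure \<Rightarrow> bool" where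
  "random_sample M X P \<longleftrightarrow>
     prob_space.indep_vars M (\<lambda>_. borel) X {1..} \<and> (\<forall>n\<ge>1. distr M borel (X n) = P)"

section \<open>Moment-type estimators\<close>

definition sample_mean :: "nat \<Rightarrow> (nat \<Rightarrow> 'b::real_vector) \<Rightarrow> 'b" where
  "sample_mean N f = (1 / real N) *\<^sub>R (\<Sum>n=1..N. f n)"

definition mean_of ::
    "('p \<Rightarrow> 'b measure) \<Rightarrow> ('b \<Rightarrow> real^'m) \<Rightarrow> 'p \<Rightarrow> real^'m" where
  "mean_of P h \<theta> = (\<integral>x. h x \<partial>P \<theta>)"

definition covariance_of ::
    "('p \<Rightarrow> 'b measure) \<Rightarrow> ('b \<Rightarrow> real^'m) \<Rightarrow> 'p \<Rightarrow> real^'m^'m" where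
  "covariance_of P h \<theta> =
     (\<chi> i j. \<integral>x. (h x $ i - mean_of P h \<theta> $ i) * (h x $ j - mean_of P h \<theta> $ j) \<partial>P \<theta>)"

text \<open>
  \<open>T N x\<close> is the value of the estimator on the sample \<open>x 1, \<dots>, x N\<close>. Values of \<open>h\<close> outside the
  support of the family \<open>P\<close> do not affect \<^const>\<open>mean_of\<close>.
\<close>

definition moment_type_estimator ::
    "('p \<Rightarrow> 'b measure) \<Rightarrow> 'p set \<Rightarrow> ('b \<Rightarrow> real^'m) \<Rightarrow> (real^'m \<Rightarrow> 'p) \<Rightarrow>
     (nat \<Rightarrow> (nat \<Rightarrow> 'b) \<Rightarrow> 'p) \<Rightarrow> bool" where
  "moment_type_estimator P \<Theta> h g T \<longleftrightarrow>
     (\<forall>\<theta>\<in>\<Theta>. integrable (P \<theta>) h) \<and>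
     inj_on (mean_of P h) \<Theta> \<and>
     (\<forall>y \<in> mean_of P h ` \<Theta>. g y = the_inv_into \<Theta> (mean_of P h) y) \<and>
     (\<forall>N\<ge>1. \<forall>x. T N x = g (sample_mean N (\<lambda>n. h (x n))))"

section \<open>The Multivariate Gamma distribution\<close>

text \<open>\<open>\<Delta>x = (x\<^sub>1, x\<^sub>2 - x\<^sub>1, \<dots>, x\<^sub>k - x\<^sub>k\<^sub>-\<^sub>1)\<close>; the predecessor of \<open>i\<close> is \<open>Max {..<i}\<close>.\<close>

definition increments :: "real^'k::{finite,wellorder} \<Rightarrow> real^'k::_" where
  "increments x = (\<chi> i. if {..<i} = {} then x $ i else x $ i - x $ Max {..<i})"

definition mgamma_density ::
    "real^'k::{finite,wellorder} \<Rightarrow> real \<Rightarrow> real^'k::_ \<Rightarrow> real" where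
  "mgamma_density \<alpha> \<beta> x =
     (if (\<forall>i. 0 < x $ i) \<and> (\<forall>i j. i < j \<longrightarrow> x $ i < x $ j)
      then 1 / (\<beta> powr (\<Sum>i\<in>UNIV. \<alpha> $ i) * (\<Prod>i\<in>UNIV. Gamma (\<alpha> $ i))) *
           exp (- (x $ Max UNIV) / \<beta>) * (\<Prod>i\<in>UNIV. (increments x $ i) powr (\<alpha> $ i - 1))
      else 0)"

definition mgamma :: "real^'k::{finite,wellorder} \<Rightarrow> real \<Rightarrow> (real^'k::_) measure" where
  "mgamma \<alpha> \<beta> = density lborel (\<lambda>x. ennreal (mgamma_density \<alpha> \<beta> x))"

definition mgamma_param :: "real^'k \<Rightarrow> real \<Rightarrow> real^('k + 1)" where
  "mgamma_param \<alpha> \<beta> = (\<chi> i. case i of Inl i \<Rightarrow> \<alpha> $ i | Inr _ \<Rightarrow> \<beta>)"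

definition mgamma_params :: "(real^('k::finite + 1)) set" where
  "mgamma_params = {\<theta>. \<forall>i. 0 < \<theta> $ i}"

definition mgamma_family :: "real^('k::{finite,wellorder} + 1) \<Rightarrow> (real^'k::_) measure" where
  "mgamma_family \<theta> = mgamma (\<chi> i. \<theta> $ Inl i) (\<theta> $ Inr 1)"

section \<open>The Moment Estimator\<close>

text \<open>
  The formulas for \<open>moment_g\<close> and \<open>moment_estimator\<close> are undefined where a denominator vanishes;
  the arbitrary values taken there are those given by \<open>x / 0 = 0\<close>.
\<close>

definition moment_h :: "real^'k::{finite,wellorder} \<Rightarrow> real^('k + 'k)" where
  "moment_h x = (\<chi> i. case i of Inl j \<Rightarrow> increments x $ j | Inr j \<Rightarrow> (increments x $ j)\<^sup>2)"

definition moment_g_scale :: "real^('k::finite + 'k) \<Rightarrow> real" where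
  "moment_g_scale y =
     1 / real CARD('k) * (\<Sum>j\<in>UNIV. (y $ Inr j - (y $ Inl j)\<^sup>2) / y $ Inl j)"

definition moment_g :: "real^('k::finite + 'k) \<Rightarrow> real^('k + 1)" where
  "moment_g y = (\<chi> i. case i of Inl i \<Rightarrow> y $ Inl i / moment_g_scale y | Inr _ \<Rightarrow> moment_g_scale y)"

definition moment_estimator ::
    "nat \<Rightarrow> (nat \<Rightarrow> real^'k::{finite,wellorder}) \<Rightarrow> real^('k + 1)" where
  "moment_estimator N x =
     (let Z_mean = (\<lambda>j. sample_mean N (\<lambda>n. increments (x n) $ j));
          Z2_mean = (\<lambda>j. sample_mean N (\<lambda>n. (increments (x n) $ j)\<^sup>2));
          \<beta> = 1 / real CARD('k) * (\<Sum>j\<in>UNIV. (Z2_mean j - (Z_mean j)\<^sup>2) / Z_mean j)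
      in mgamma_param (\<chi> i. Z_mean i / \<beta>) \<beta>)"

definition moment_G :: "real^'k \<Rightarrow> real \<Rightarrow> real^('k + 'k)^('k + 1)" where
  "moment_G \<alpha> \<beta> =
     (let k = real CARD('k) in
      \<chi> r c. case r of
        Inl i \<Rightarrow> (case c of
            Inl j \<Rightarrow> \<alpha> $ i / (k * \<beta>) * (2 + 1 / \<alpha> $ j) + 1 / \<beta> * (if i = j then 1 else 0)
          | Inr j \<Rightarrow> - (\<alpha> $ i / (k * \<alpha> $ j * \<beta>\<^sup>2)))
      | Inr _ \<Rightarrow> (case c of
            Inl j \<Rightarrow> - (1 / k * (2 + 1 / \<alpha> $ j))
          | Inr j \<Rightarrow> 1 / (k * \<alpha> $ j * \<beta>)))"

end

theory Submission
  imports Defs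
begin

text \<open>
  The vector \<open>Z = \<Delta>X\<close> of increments has independent gamma distributed components with shapes \<open>\<alpha>\<^sub>j\<close> and common
  scale \<open>\<beta>\<close>: the increments are a volume preserving linear map, in whose image the density is a product
  (\<open>mgamma_density_eq_prod\<close>, \<open>lborel_increments\<close>). Hence \<open>Z\<^sub>j\<close> has mean \<open>\<alpha>\<^sub>j \<beta>\<close> and variance \<open>\<alpha>\<^sub>j \<beta>\<^sup>2\<close>, so the
  quotient of variance and mean is \<open>\<beta>\<close> for every \<open>j\<close>, and \<open>g\<close> recovers \<open>(\<alpha>, \<beta>)\<close> from the first two moments
  (\<open>moment_g_gamma_moments\<close>). This gives the injectivity of \<open>e\<^sub>h\<close> as well as the moment-type property.

  The estimator is \<open>g\<close> of the sample mean of the independent square integrable vectors \<open>h (X\<^sub>n)\<close>, and \<open>g\<close> is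
  differentiable at their expectation with Jacobian matrix \<open>G\<close> (\<open>moment_g_has_derivative\<close>). So the asymptotic
  covariance matrix is \<open>G V G\<^sup>T\<close> by the delta method (\<open>delta_method\<close>).

  The multivariate probability theory behind this is built from its one-dimensional counterpart. Characteristic
  functions determine convergence in law (\<open>levy_continuity_euclidean\<close>): trigonometric polynomials approximate
  continuous functions on cubes, and the contribution outside of the cubes is controlled by the coordinates.
  The limit law \<open>N(0, G V G\<^sup>T)\<close> is the image of a standard normal vector under a linear map obtained by
  Cholesky elimination (\<open>centered_normal_exists\<close>). The characteristic functions of \<open>sqrt N * (g(mean) - \<theta>)\<close>
  are compared with those of the linearized error, where the central limit theorem on the line applies,
  by a second moment bound (\<open>char_linearization\<close>).
\<close>

section \<open>Levy's continuity theorem in Euclidean spaces\<close>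

text \<open>
  Characteristic functions determine the expectations of trigonometric polynomials. These are dense among the
  continuous functions on compact sets, which carries convergence of expectations over to all bounded
  continuous functions.
\<close>

inductive trig_poly :: "('b::euclidean_space \<Rightarrow> real) \<Rightarrow> bool" where
  trig_cos: "trig_poly (\<lambda>x. cos (t \<bullet> x))"
| trig_sin: "trig_poly (\<lambda>x. sin (t \<bullet> x))"
| trig_add: "trig_poly p \<Longrightarrow> trig_poly q \<Longrightarrow> trig_poly (\<lambda>x. p x + q x)"
| trig_scale: "trig_poly p \<Longrightarrow> trig_poly (\<lambda>x. c * p x)"

lemma trig_poly_const: "trig_poly (\<lambda>x. c)"
  using trig_scale[OF trig_cos[of 0], of c] by simp

lemma trig_poly_continuous: "trig_poly p \<Longrightarrow> continuous_on UNIV p"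
  by (induction rule: trig_poly.induct) (intro continuous_intros; assumption)+

lemma trig_poly_bounded: "trig_poly p \<Longrightarrow> \<exists>K. \<forall>x. \<bar>p x\<bar> \<le> K"
proof (induction rule: trig_poly.induct)
  case (trig_add p q)
  then obtain K L where "\<forall>x. \<bar>p x\<bar> \<le> K" "\<forall>x. \<bar>q x\<bar> \<le> L" by blast
  then have "\<forall>x. \<bar>p x + q x\<bar> \<le> K + L" by (meson abs_triangle_ineq add_mono order_trans)
  then show ?case by blast
next
  case (trig_scale p c)
  then obtain K where "\<forall>x. \<bar>p x\<bar> \<le> K" by blast
  then have "\<forall>x. \<bar>c * p x\<bar> \<le> \<bar>c\<bar> * K" by (simp add: abs_mult mult_left_mono)
  then show ?case by blast
qed (auto intro: exI[of _ 1])

text \<open>The product-to-sum identities make the trigonometric polynomials an algebra.\<close>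

lemma trig_poly_mult:
  assumes "trig_poly p" "trig_poly q"
  shows "trig_poly (\<lambda>x. p x * q x)"
  using assms(1)
proof (induction rule: trig_poly.induct)
  case (trig_cos t)
  show ?case using assms(2)
  proof (induction rule: trig_poly.induct)
    case (trig_cos s)
    have "trig_poly (\<lambda>x. (1/2) * (cos ((t - s) \<bullet> x) + cos ((t + s) \<bullet> x)))"
      by (rule trig_poly.trig_scale[OF trig_poly.trig_add[OF trig_poly.trig_cos trig_poly.trig_cos]])
    moreover have "(\<lambda>x. cos (t \<bullet> x) * cos (s \<bullet> x)) = (\<lambda>x. (1/2) * (cos ((t - s) \<bullet> x) + cos ((t + s) \<bullet> x)))"
      by (simp add: fun_eq_iff inner_left_distrib inner_diff_left cos_times_cos)
    ultimately show ?case by simp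
  next
    case (trig_sin s)
    have "trig_poly (\<lambda>x. (1/2) * (sin ((t + s) \<bullet> x) + (-1) * sin ((t - s) \<bullet> x)))"
      by (rule trig_poly.trig_scale[OF trig_poly.trig_add[OF trig_poly.trig_sin trig_poly.trig_scale[OF trig_poly.trig_sin]]])
    moreover have "(\<lambda>x. cos (t \<bullet> x) * sin (s \<bullet> x)) = (\<lambda>x. (1/2) * (sin ((t + s) \<bullet> x) + (-1) * sin ((t - s) \<bullet> x)))"
      by (simp add: fun_eq_iff inner_left_distrib inner_diff_left cos_times_sin)
    ultimately show ?case by simp
  next
    case (trig_add p q)
    then show ?case by (simp add: distrib_left trig_poly.trig_add)
  next
    case (trig_scale p c)
    then show ?case by (simp add: mult.left_commute trig_poly.trig_scale)
  qed
next
  case (trig_sin t)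
  show ?case using assms(2)
  proof (induction rule: trig_poly.induct)
    case (trig_cos s)
    have "trig_poly (\<lambda>x. (1/2) * (sin ((t + s) \<bullet> x) + sin ((t - s) \<bullet> x)))"
      by (rule trig_poly.trig_scale[OF trig_poly.trig_add[OF trig_poly.trig_sin trig_poly.trig_sin]])
    moreover have "(\<lambda>x. sin (t \<bullet> x) * cos (s \<bullet> x)) = (\<lambda>x. (1/2) * (sin ((t + s) \<bullet> x) + sin ((t - s) \<bullet> x)))"
      by (simp add: fun_eq_iff inner_left_distrib inner_diff_left sin_times_cos)
    ultimately show ?case by simp
  next
    case (trig_sin s)
    have "trig_poly (\<lambda>x. (1/2) * (cos ((t - s) \<bullet> x) + (-1) * cos ((t + s) \<bullet> x)))"
      by (rule trig_poly.trig_scale[OF trig_poly.trig_add[OF trig_poly.trig_cos trig_poly.trig_scale[OF trig_poly.trig_cos]]])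
    moreover have "(\<lambda>x. sin (t \<bullet> x) * sin (s \<bullet> x)) = (\<lambda>x. (1/2) * (cos ((t - s) \<bullet> x) + (-1) * cos ((t + s) \<bullet> x)))"
      by (simp add: fun_eq_iff inner_left_distrib inner_diff_left sin_times_sin)
    ultimately show ?case by simp
  next
    case (trig_add p q)
    then show ?case by (simp add: distrib_left trig_poly.trig_add)
  next
    case (trig_scale p c)
    then show ?case by (simp add: mult.left_commute trig_poly.trig_scale)
  qed
next
  case (trig_add p q')
  then show ?case by (simp add: distrib_right trig_poly.trig_add)
next
  case (trig_scale p c)
  then show ?case by (simp add: mult.assoc trig_poly.trig_scale)
qed

text \<open>
  For \<open>t\<close> with \<open>t \<bullet> (x - y) = 1\<close>, the trigonometric polynomial \<open>z \<mapsto> sin (t \<bullet> (z - y))\<close> takes the values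
  \<open>sin 1\<close> at \<open>x\<close> and \<open>0\<close> at \<open>y\<close>.
\<close>

lemma trig_poly_separates:
  assumes "x \<noteq> y"
  shows "\<exists>p. trig_poly p \<and> p x \<noteq> p y"
proof -
  define t where "t = (1 / ((x - y) \<bullet> (x - y))) *\<^sub>R (x - y)"
  have t: "t \<bullet> (x - y) = 1"
    using assms by (simp add: t_def)
  let ?p = "\<lambda>z. cos (t \<bullet> y) * sin (t \<bullet> z) + (- sin (t \<bullet> y)) * cos (t \<bullet> z)"
  have p: "?p z = sin (t \<bullet> (z - y))" for z
    by (simp add: inner_diff_right sin_diff mult.commute)
  have "trig_poly ?p" by (intro trig_poly.intros)
  moreover have "?p x \<noteq> ?p y"
    unfolding p using t sin_gt_zero[of 1] pi_gt3 by simp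
  ultimately show ?thesis by blast
qed

lemma trig_poly_dense:
  assumes "compact S" "continuous_on S f" "0 < e"
  shows "\<exists>p. trig_poly p \<and> (\<forall>x\<in>S. \<bar>f x - p x\<bar> < e)"
proof (rule Stone_Weierstrass_HOL[where P=trig_poly])
  show "continuous_on S p" if "trig_poly p" for p
    using trig_poly_continuous[OF that] by (rule continuous_on_subset) simp
  show "trig_poly (\<lambda>x. c)" for c by (rule trig_poly_const)
  show "trig_poly (\<lambda>x. p x + q x)" "trig_poly (\<lambda>x. p x * q x)" if "trig_poly p \<and> trig_poly q" for p q
    using that by (simp_all add: trig_add trig_poly_mult)
  show "\<exists>p. trig_poly p \<and> p x \<noteq> p y" if "x \<in> S \<and> y \<in> S \<and> x \<noteq> y" for x y
    using that by (simp add: trig_poly_separates)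
qed (use assms in simp_all)

lemma trig_poly_compose_polynomial:
  assumes "real_polynomial_function g" "trig_poly p"
  shows "trig_poly (\<lambda>x. g (p x))"
  using assms
proof (induction rule: real_polynomial_function.induct)
  case (linear f)
  have "f = (\<lambda>y. f 1 * y)"
  proof
    show "f y = f 1 * y" for y
      using linear_simps(5)[OF linear(1), of y 1] by (simp add: mult.commute)
  qed
  then show ?case using trig_scale[OF assms(2), of "f 1"] by metis
qed (use trig_poly_const trig_add trig_poly_mult assms(2) in simp_all)

text \<open>
  For fixed laws, these functions form a vector space that contains the trigonometric polynomials if the
  characteristic functions converge; the closure properties below enlarge it to all bounded continuous
  functions.
\<close>

definition expectation_converges :: "(nat \<Rightarrow> 'b::topological_space measure) \<Rightarrow> 'b measure \<Rightarrow> ('b \<Rightarrow> real) \<Rightarrow> bool" where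
  "expectation_converges \<mu>s \<mu> f \<longleftrightarrow> continuous_on UNIV f \<and> bounded (range f) \<and>
     (\<lambda>N. integral\<^sup>L (\<mu>s N) f) \<longlonglongrightarrow> integral\<^sup>L \<mu> f"

context
  fixes \<mu>s :: "nat \<Rightarrow> 'b::euclidean_space measure" and \<mu> :: "'b measure"
  assumes prob_seq: "\<And>N. prob_space (\<mu>s N)" and prob_lim: "prob_space \<mu>"
    and sets_seq: "\<And>N. sets (\<mu>s N) = sets borel" and sets_lim: "sets \<mu> = sets borel"
begin

abbreviation "EC \<equiv> expectation_converges \<mu>s \<mu>"

lemma bounded_continuous_integrable:
  fixes f :: "'b \<Rightarrow> 'c::{banach,second_countable_topology}"
  assumes "prob_space \<nu>" "sets \<nu> = sets borel" "continuous_on UNIV f" "bounded (range f)"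
  shows "integrable \<nu> f"
proof -
  obtain B where "\<And>x. norm (f x) \<le> B" using assms(4) by (auto simp: bounded_iff)
  then show ?thesis
    using assms
    by (intro finite_measure.integrable_const_bound[where B=B] prob_space.finite_measure)
       (auto simp: measurable_cong_sets[OF assms(2) refl] borel_measurable_continuous_onI)
qed

lemma EC_integrable: "EC f \<Longrightarrow> integrable (\<mu>s N) f" "EC f \<Longrightarrow> integrable \<mu> f"
  using bounded_continuous_integrable prob_seq prob_lim sets_seq sets_lim
  unfolding expectation_converges_def by blast+

lemma EC_const: "EC (\<lambda>x. c)"
  using prob_space.prob_space[OF prob_seq] prob_space.prob_space[OF prob_lim]
  by (simp add: expectation_converges_def)

lemma EC_add:
  assumes "EC f" "EC g"
  shows "EC (\<lambda>x. f x + g x)"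
  using EC_integrable assms
  by (auto simp: expectation_converges_def bounded_plus_comp intro!: continuous_intros tendsto_add)

lemma EC_scale:
  assumes "EC f"
  shows "EC (\<lambda>x. c * f x)"
proof -
  have "bounded (range (\<lambda>x. c *\<^sub>R f x))"
    using assms by (intro bounded_scaleR_comp) (auto simp: expectation_converges_def)
  then show ?thesis using assms
    by (auto simp: expectation_converges_def intro!: continuous_intros tendsto_mult)
qed

lemma EC_sum: "finite I \<Longrightarrow> (\<And>i. i \<in> I \<Longrightarrow> EC (f i)) \<Longrightarrow> EC (\<lambda>x. \<Sum>i\<in>I. f i x)"
  by (induction I rule: finite_induct) (auto intro: EC_const EC_add)

text \<open>
  The error may be controlled by a function \<open>h\<close> rather than by a constant, because only the limit
  expectation of \<open>h\<close> has to be small: the expectations of \<open>h\<close> along the sequence are then eventually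
  small too. This is what replaces tightness below, with an \<open>h\<close> that is large far from the origin.
\<close>

lemma EC_sandwich:
  assumes f: "continuous_on UNIV f" "bounded (range f)"
    and approx: "\<And>e. e > 0 \<Longrightarrow> \<exists>q h. EC q \<and> EC h \<and> (\<forall>x. \<bar>f x - q x\<bar> \<le> h x) \<and> integral\<^sup>L \<mu> h \<le> e"
  shows "EC f"
proof -
  have fi: "integrable (\<mu>s N) f" "integrable \<mu> f" for N
    using bounded_continuous_integrable prob_seq prob_lim sets_seq sets_lim f by blast+
  have "(\<lambda>N. integral\<^sup>L (\<mu>s N) f) \<longlonglongrightarrow> integral\<^sup>L \<mu> f"
  proof (rule LIMSEQ_I)
    fix r :: real assume "r > 0"
    then obtain q h where q: "EC q" and h: "EC h" and qh: "\<And>x. \<bar>f x - q x\<bar> \<le> h x"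
      and small: "integral\<^sup>L \<mu> h \<le> r / 4"
      using approx[of "r / 4"] by auto
    note [simp] = fi EC_integrable[OF q] EC_integrable[OF h]
    have err: "\<bar>integral\<^sup>L \<nu> f - integral\<^sup>L \<nu> q\<bar> \<le> integral\<^sup>L \<nu> h"
      if "integrable \<nu> f" "integrable \<nu> q" "integrable \<nu> h" for \<nu>
    proof -
      have "\<bar>integral\<^sup>L \<nu> f - integral\<^sup>L \<nu> q\<bar> \<le> (\<integral>x. \<bar>f x - q x\<bar> \<partial>\<nu>)"
        using that integral_abs_bound[of \<nu> "\<lambda>x. f x - q x"] by simp
      also have "\<dots> \<le> integral\<^sup>L \<nu> h"
        using that qh by (intro integral_mono) auto
      finally show ?thesis .
    qed
    have lims: "(\<lambda>N. integral\<^sup>L (\<mu>s N) q) \<longlonglongrightarrow> integral\<^sup>L \<mu> q" "(\<lambda>N. integral\<^sup>L (\<mu>s N) h) \<longlonglongrightarrow> integral\<^sup>L \<mu> h"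
      using q h by (simp_all add: expectation_converges_def)
    have "eventually (\<lambda>N. \<bar>integral\<^sup>L (\<mu>s N) q - integral\<^sup>L \<mu> q\<bar> < r / 8 \<and>
              \<bar>integral\<^sup>L (\<mu>s N) h - integral\<^sup>L \<mu> h\<bar> < r / 8) sequentially"
      using lims \<open>r > 0\<close> by (intro eventually_conj) (auto dest!: tendstoD[where e="r / 8"] simp: dist_real_def)
    then have "eventually (\<lambda>N. norm (integral\<^sup>L (\<mu>s N) f - integral\<^sup>L \<mu> f) < r) sequentially"
    proof (eventually_elim)
      case (elim N)
      then show ?case
        using err[OF fi(1) EC_integrable(1)[OF q] EC_integrable(1)[OF h], of N]
          err[OF fi(2) EC_integrable(2)[OF q] EC_integrable(2)[OF h]] small \<open>r > 0\<close>
        unfolding real_norm_def by linarith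
    qed
    then show "\<exists>no. \<forall>n\<ge>no. norm (integral\<^sup>L (\<mu>s n) f - integral\<^sup>L \<mu> f) < r"
      by (simp add: eventually_sequentially)
  qed
  then show ?thesis using f by (simp add: expectation_converges_def)
qed

lemma EC_uniform_limit:
  assumes "continuous_on UNIV f" "bounded (range f)"
    and "\<And>e. e > 0 \<Longrightarrow> \<exists>q. EC q \<and> (\<forall>x. \<bar>f x - q x\<bar> \<le> e)"
  shows "EC f"
proof (rule EC_sandwich)
  fix e :: real assume "e > 0"
  then obtain q where "EC q" "\<forall>x. \<bar>f x - q x\<bar> \<le> e" using assms(3) by blast
  moreover have "integral\<^sup>L \<mu> (\<lambda>x. e) \<le> e"
    using prob_space.prob_space[OF prob_lim] by simp
  ultimately show "\<exists>q h. EC q \<and> EC h \<and> (\<forall>x. \<bar>f x - q x\<bar> \<le> h x) \<and> integral\<^sup>L \<mu> h \<le> e"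
    using EC_const[of e] by blast
qed (use assms in auto)

context
  assumes char_conv: "\<And>t. (\<lambda>N. \<integral>x. iexp (t \<bullet> x) \<partial>\<mu>s N) \<longlonglongrightarrow> (\<integral>x. iexp (t \<bullet> x) \<partial>\<mu>)"
begin

lemma EC_Re_Im_char:
  shows EC_cos: "EC (\<lambda>x. cos (t \<bullet> x))" and EC_sin: "EC (\<lambda>x. sin (t \<bullet> x))"
proof -
  have cont: "continuous_on UNIV (\<lambda>x. cos (t \<bullet> x))" "continuous_on UNIV (\<lambda>x. sin (t \<bullet> x))"
    by (intro continuous_intros)+
  have "norm (cos (t \<bullet> x)) \<le> 1" "norm (sin (t \<bullet> x)) \<le> 1" for x by simp_all
  then have bdd: "bounded (range (\<lambda>x. cos (t \<bullet> x)))" "bounded (range (\<lambda>x. sin (t \<bullet> x)))"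
    unfolding bounded_iff by blast+
  have int: "integrable \<nu> (\<lambda>x. iexp (t \<bullet> x))" if "prob_space \<nu>" "sets \<nu> = sets borel" for \<nu> :: "'b measure"
  proof (rule bounded_continuous_integrable[OF that])
    show "continuous_on UNIV (\<lambda>x. iexp (t \<bullet> x))" by (intro continuous_intros)
    have "norm (iexp (t \<bullet> x)) \<le> 1" for x by simp
    then show "bounded (range (\<lambda>x. iexp (t \<bullet> x)))" unfolding bounded_iff by blast
  qed
  have re: "integral\<^sup>L \<nu> (\<lambda>x. cos (t \<bullet> x)) = Re (\<integral>x. iexp (t \<bullet> x) \<partial>\<nu>)"
    and im: "integral\<^sup>L \<nu> (\<lambda>x. sin (t \<bullet> x)) = Im (\<integral>x. iexp (t \<bullet> x) \<partial>\<nu>)"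
    if "prob_space \<nu>" "sets \<nu> = sets borel" for \<nu> :: "'b measure"
    using integral_Re[OF int[OF that]] integral_Im[OF int[OF that]] by (simp_all add: Re_exp Im_exp)
  show "EC (\<lambda>x. cos (t \<bullet> x))" "EC (\<lambda>x. sin (t \<bullet> x))"
    unfolding expectation_converges_def
    using cont bdd tendsto_Re[OF char_conv[of t]] tendsto_Im[OF char_conv[of t]]
    by (simp_all add: re im prob_seq prob_lim sets_seq sets_lim)
qed

lemma EC_trig_poly: "trig_poly p \<Longrightarrow> EC p"
proof (induction rule: trig_poly.induct)
  case (trig_cos t)
  show ?case by (rule EC_cos)
next
  case (trig_sin t)
  show ?case by (rule EC_sin)
next
  case (trig_add p q)
  then show ?case by (intro EC_add)
next
  case (trig_scale p c)
  then show ?case by (intro EC_scale)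
qed

text \<open>
  Trigonometric polynomials are stable under composition with polynomials, and by Weierstrass's theorem
  \<open>c\<close> is a uniform limit of polynomials on the bounded range of \<open>p\<close>. The case of interest is a truncation
  \<open>c\<close>: on a compact set, \<open>p\<close> approximates a function bounded by \<open>B\<close>, but \<open>p\<close> may be much larger than
  \<open>B\<close> elsewhere, whereas the truncation of \<open>p\<close> is not.
\<close>

lemma EC_compose_trig_poly:
  assumes p: "trig_poly p" and c: "continuous_on UNIV (c :: real \<Rightarrow> real)"
  shows "EC (\<lambda>x. c (p x))"
proof -
  obtain K where K: "\<And>x. \<bar>p x\<bar> \<le> K" using trig_poly_bounded[OF p] by blast
  have cp: "continuous_on UNIV (\<lambda>x. c (p x))"
    using continuous_on_compose2[OF c trig_poly_continuous[OF p]] by simp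
  have "compact (c ` {-K..K})"
    using c by (intro compact_continuous_image) (auto intro: continuous_on_subset)
  moreover have "range (\<lambda>x. c (p x)) \<subseteq> c ` {-K..K}"
    using K by (auto simp: abs_le_iff minus_le_iff)
  ultimately have bcp: "bounded (range (\<lambda>x. c (p x)))"
    using bounded_subset compact_imp_bounded by blast
  show ?thesis
  proof (rule EC_uniform_limit[OF cp bcp])
    fix e :: real assume "e > 0"
    obtain g where g: "real_polynomial_function g" "\<And>y. y \<in> {-K..K} \<Longrightarrow> \<bar>c y - g y\<bar> < e"
      using Stone_Weierstrass_real_polynomial_function[of "{-K..K}" c e] c \<open>e > 0\<close>
      by (metis compact_Icc continuous_on_subset subset_UNIV)
    have "\<bar>c (p x) - g (p x)\<bar> \<le> e" for x
      using g(2)[of "p x"] K[of x] by (intro less_imp_le) (simp add: abs_le_iff minus_le_iff)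
    then show "\<exists>q. EC q \<and> (\<forall>x. \<bar>c (p x) - q x\<bar> \<le> e)"
      using EC_trig_poly[OF trig_poly_compose_polynomial[OF g(1) p]] by blast
  qed
qed

text \<open>
  The characteristic function of the law of \<open>t \<bullet> x\<close> at \<open>s\<close> is that of the law of \<open>x\<close> at \<open>s *\<^sub>R t\<close>, so Levy's
  theorem on the line applies to the projections.
\<close>

lemma EC_compose_projection:
  assumes c: "continuous_on UNIV (c :: real \<Rightarrow> real)" and b: "bounded (range c)"
  shows "EC (\<lambda>x. c (t \<bullet> x))"
proof -
  have rd: "real_distribution (distr \<nu> borel (\<lambda>x. t \<bullet> x))"
    if "prob_space \<nu>" "sets \<nu> = sets borel" for \<nu> :: "'b measure"
    using that by (intro prob_space.real_distribution_distr) (auto simp: measurable_cong_sets[OF that(2) refl])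
  have ch: "char (distr \<nu> borel (\<lambda>x. t \<bullet> x)) s = (\<integral>x. iexp ((s *\<^sub>R t) \<bullet> x) \<partial>\<nu>)"
    if "prob_space \<nu>" "sets \<nu> = sets borel" for s and \<nu> :: "'b measure"
    unfolding char_def
    by (subst integral_distr) (auto simp: measurable_cong_sets[OF that(2) refl])
  have int: "integral\<^sup>L (distr \<nu> borel (\<lambda>x. t \<bullet> x)) c = integral\<^sup>L \<nu> (\<lambda>x. c (t \<bullet> x))"
    if "prob_space \<nu>" "sets \<nu> = sets borel" for \<nu> :: "'b measure"
    using c by (subst integral_distr) (auto simp: measurable_cong_sets[OF that(2) refl] borel_measurable_continuous_onI)
  have wc: "weak_conv_m (\<lambda>N. distr (\<mu>s N) borel (\<lambda>x. t \<bullet> x)) (distr \<mu> borel (\<lambda>x. t \<bullet> x))"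
    by (intro levy_continuity rd)
       (simp_all add: ch prob_seq prob_lim sets_seq sets_lim char_conv[of "_ *\<^sub>R t", simplified])
  obtain B where B: "\<And>x. norm (c x) \<le> B" using b by (auto simp: bounded_iff)
  have "(\<lambda>N. integral\<^sup>L (distr (\<mu>s N) borel (\<lambda>x. t \<bullet> x)) c) \<longlonglongrightarrow> integral\<^sup>L (distr \<mu> borel (\<lambda>x. t \<bullet> x)) c"
    by (rule weak_conv_imp_integral_bdd_continuous_conv[OF _ _ wc _ B])
       (use c rd in \<open>simp_all add: prob_seq prob_lim sets_seq sets_lim continuous_on_eq_continuous_at\<close>)
  moreover have "continuous_on UNIV (\<lambda>x. c (t \<bullet> x))"
    using continuous_on_compose2[OF c, of UNIV "\<lambda>x. t \<bullet> x"] by (simp add: continuous_on_inner)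
  moreover have "bounded (range (\<lambda>x. c (t \<bullet> x)))"
    using B by (auto simp: bounded_iff)
  ultimately show ?thesis
    by (simp add: expectation_converges_def int prob_seq prob_lim sets_seq sets_lim)
qed

text \<open>
  A continuous substitute for the indicator of \<open>\<bar>s\<bar> > R\<close>; it equals 1 for \<open>\<bar>s\<bar> \<ge> R + 1\<close>.
\<close>

definition excess :: "nat \<Rightarrow> real \<Rightarrow> real" where
  "excess R s = min 1 (max 0 (\<bar>s\<bar> - real R))"

lemma EC_excess: "EC (\<lambda>x. \<Sum>b\<in>Basis. excess R (b \<bullet> x))"
proof (rule EC_sum[OF finite_Basis], rule EC_compose_projection)
  show "continuous_on UNIV (excess R)"
    unfolding excess_def by (intro continuous_intros)
  have "norm (excess R s) \<le> 1" for s by (simp add: excess_def)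
  then show "bounded (range (excess R))" unfolding bounded_iff by blast
qed

lemma excess_vanishes: "(\<lambda>R. integral\<^sup>L \<mu> (\<lambda>x. \<Sum>b\<in>Basis. excess R (b \<bullet> x))) \<longlonglongrightarrow> 0"
proof -
  have "(\<lambda>R. \<integral>x. (\<Sum>b\<in>Basis. excess R (b \<bullet> x)) \<partial>\<mu>) \<longlonglongrightarrow> integral\<^sup>L \<mu> (\<lambda>x. 0)"
  proof (rule integral_dominated_convergence[where w="\<lambda>x. real DIM('b)"])
    show "(\<lambda>x. \<Sum>b\<in>Basis. excess R (b \<bullet> x)) \<in> borel_measurable \<mu>" for R
      using EC_integrable(2)[OF EC_excess] by (rule borel_measurable_integrable)
    show "integrable \<mu> (\<lambda>x. real DIM('b))"
      using EC_integrable(2)[OF EC_const] .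
    show "AE x in \<mu>. (\<lambda>R. \<Sum>b\<in>Basis. excess R (b \<bullet> x)) \<longlonglongrightarrow> 0"
    proof (rule AE_I2)
      fix x :: 'b
      have "(\<lambda>R. excess R (b \<bullet> x)) \<longlonglongrightarrow> 0" for b
      proof (rule tendsto_eventually)
        obtain n where "\<bar>b \<bullet> x\<bar> \<le> real n" using real_arch_simple by blast
        then show "eventually (\<lambda>R. excess R (b \<bullet> x) = 0) sequentially"
          by (intro eventually_sequentiallyI[of n]) (auto simp: excess_def)
      qed
      then show "(\<lambda>R. \<Sum>b\<in>Basis. excess R (b \<bullet> x)) \<longlonglongrightarrow> 0"
        by (intro tendsto_null_sum) auto
    qed
    show "AE x in \<mu>. norm (\<Sum>b\<in>Basis. excess R (b \<bullet> x)) \<le> real DIM('b)" for R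
    proof (rule AE_I2)
      fix x :: 'b
      have "norm (\<Sum>b\<in>Basis. excess R (b \<bullet> x)) \<le> (\<Sum>b\<in>(Basis::'b set). 1)"
        by (intro sum_norm_le) (auto simp: excess_def)
      then show "norm (\<Sum>b\<in>Basis. excess R (b \<bullet> x)) \<le> real DIM('b)" by simp
    qed
  qed simp
  then show ?thesis by simp
qed

text \<open>
  Let \<open>\<bar>f\<bar> \<le> B\<close>. On a large cube, \<open>f\<close> is close to a trigonometric polynomial by the Stone-Weierstrass
  theorem, hence to its truncation at \<open>\<plusminus>B\<close>. Outside the cube both are bounded by \<open>B\<close>, and some coordinate
  is large, so that \<open>2 * B\<close> times the sum of the excesses of the coordinates dominates their difference.
  By dominated convergence this sum has small expectation under \<open>\<mu>\<close> if the cube is large.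
\<close>

theorem levy_continuity_euclidean: "weakly_converges \<mu>s \<mu>"
  unfolding weakly_converges_def
proof (intro allI impI)
  fix f :: "'b \<Rightarrow> real" assume f: "continuous_on UNIV f" "bounded (range f)"
  obtain B where B: "\<And>x. \<bar>f x\<bar> \<le> B" and "B > 0"
    using f(2) by (auto simp: bounded_pos)
  have "EC f"
  proof (rule EC_sandwich[OF f])
    fix e :: real assume e: "e > 0"
    have "eventually (\<lambda>R. norm (integral\<^sup>L \<mu> (\<lambda>x. \<Sum>b\<in>Basis. excess R (b \<bullet> x)) - 0) < e / (4 * B)) sequentially"
      using tendstoD[OF excess_vanishes, of "e / (4 * B)"] e \<open>B > 0\<close> by (simp add: dist_norm)
    then obtain R where "norm (integral\<^sup>L \<mu> (\<lambda>x. \<Sum>b\<in>Basis. excess R (b \<bullet> x)) - 0) < e / (4 * B)"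
      unfolding eventually_sequentially by (meson order_refl)
    then have R: "integral\<^sup>L \<mu> (\<lambda>x. \<Sum>b\<in>Basis. excess R (b \<bullet> x)) \<le> e / (4 * B)"
      by simp
    define S where "S = cbox (\<Sum>b\<in>Basis. (- real R - 1) *\<^sub>R b) ((\<Sum>b\<in>Basis. (real R + 1) *\<^sub>R b) :: 'b)"
    have S: "x \<in> S \<longleftrightarrow> (\<forall>b\<in>Basis. \<bar>b \<bullet> x\<bar> \<le> real R + 1)" for x
      by (auto simp: S_def mem_box inner_commute[of x] abs_le_iff)
    obtain p where p: "trig_poly p" "\<And>x. x \<in> S \<Longrightarrow> \<bar>f x - p x\<bar> < e / 2"
      using trig_poly_dense[of S f "e / 2"] continuous_on_subset[OF f(1), of S] e compact_cbox
      unfolding S_def by (metis half_gt_zero subset_UNIV)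
    define clamp where "clamp s = max (- B) (min B s)" for s :: real
    let ?h = "\<lambda>x. e / 2 + (2 * B) * (\<Sum>b\<in>Basis. excess R (b \<bullet> x))"
    have "\<bar>f x - clamp (p x)\<bar> \<le> ?h x" for x
    proof (cases "x \<in> S")
      case True
      have "\<bar>f x - clamp (p x)\<bar> \<le> \<bar>f x - p x\<bar>"
        using B[of x] unfolding clamp_def by linarith
      moreover have "(\<Sum>b\<in>Basis. excess R (b \<bullet> x)) \<ge> 0"
        by (intro sum_nonneg) (auto simp: excess_def)
      ultimately show ?thesis using p(2)[OF True] \<open>B > 0\<close>
        by (smt (verit) mult_nonneg_nonneg)
    next
      case False
      then obtain b where b: "b \<in> Basis" "\<bar>b \<bullet> x\<bar> > real R + 1" by (auto simp: S not_le)
      have "1 = excess R (b \<bullet> x)" using b by (simp add: excess_def)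
      also have "\<dots> \<le> (\<Sum>b\<in>Basis. excess R (b \<bullet> x))"
        using b(1) by (intro member_le_sum) (auto simp: excess_def)
      finally have "2 * B * 1 \<le> 2 * B * (\<Sum>b\<in>Basis. excess R (b \<bullet> x))"
        using \<open>B > 0\<close> by (intro mult_left_mono) auto
      moreover have "\<bar>f x - clamp (p x)\<bar> \<le> 2 * B"
        using B[of x] \<open>B > 0\<close> unfolding clamp_def by linarith
      ultimately show ?thesis using e by simp
    qed
    moreover have "EC (\<lambda>x. clamp (p x))"
      by (rule EC_compose_trig_poly[OF p(1), of clamp])
         (auto simp: clamp_def intro!: continuous_intros)
    moreover have "EC ?h"
      by (rule EC_add[OF EC_const EC_scale[OF EC_excess]])
    moreover have "integral\<^sup>L \<mu> ?h \<le> e"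
    proof -
      have "integral\<^sup>L \<mu> ?h = e / 2 + 2 * B * integral\<^sup>L \<mu> (\<lambda>x. \<Sum>b\<in>Basis. excess R (b \<bullet> x))"
        using EC_integrable(2)[OF EC_excess[of R]] EC_integrable(2)[OF EC_const[of "e / 2"]]
          prob_space.prob_space[OF prob_lim]
        by (subst Bochner_Integration.integral_add) auto
      also have "\<dots> \<le> e / 2 + 2 * B * (e / (4 * B))"
        using R \<open>B > 0\<close> by (intro add_left_mono mult_left_mono) auto
      finally show ?thesis using \<open>B > 0\<close> by simp
    qed
    ultimately show "\<exists>q h. EC q \<and> EC h \<and> (\<forall>x. \<bar>f x - q x\<bar> \<le> h x) \<and> integral\<^sup>L \<mu> h \<le> e"
      by blast
  qed
  then show "(\<lambda>N. integral\<^sup>L (\<mu>s N) f) \<longlonglongrightarrow> integral\<^sup>L \<mu> f"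
    by (simp add: expectation_converges_def)
qed

end
end

section \<open>Centered normal distributions\<close>

lemma symmetric_matrix_inner:
  fixes S :: "real^'d^'d"
  assumes "transpose S = S"
  shows "(S *v x) \<bullet> y = x \<bullet> (S *v y)"
  by (metis assms dot_lmul_matrix vector_transpose_matrix)

text \<open>
  A positive semidefinite matrix is a sum of rank one matrices \<open>a a\<^sup>T\<close>, by Cholesky elimination on the set
  \<open>I\<close> that supports the nonzero rows. With \<open>c\<close> the \<open>k\<close>-th diagonal entry and \<open>u\<close> the \<open>k\<close>-th column, either
  \<open>c = 0\<close>, and then semidefiniteness forces \<open>u = 0\<close>, or \<open>c > 0\<close>, and then \<open>S - u u\<^sup>T / c\<close> has a vanishing
  \<open>k\<close>-th row and is still positive semidefinite, because its value at \<open>x\<close> is that of \<open>S\<close> at the minimizer of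
  the quadratic form on the line through \<open>x\<close> in direction \<open>k\<close>.
\<close>

lemma psd_gram_supported:
  fixes S :: "real^'d^'d"
  assumes "finite I" "transpose S = S" "\<And>x. 0 \<le> x \<bullet> (S *v x)"
    and "\<And>i j. i \<notin> I \<Longrightarrow> S $ i $ j = 0"
  shows "\<exists>a :: 'd \<Rightarrow> real^'d. \<forall>i j. S $ i $ j = (\<Sum>l\<in>I. a l $ i * a l $ j)"
  using assms
proof (induction I arbitrary: S rule: finite_induct)
  case empty
  then show ?case by simp
next
  case (insert k I S)
  note sym = insert.prems(1) and psd = insert.prems(2) and supp = insert.prems(3)
  have sij: "S $ i $ j = S $ j $ i" for i j
    using sym by (metis transpose_def vec_lambda_beta)
  define c where "c = S $ k $ k"
  define u where "u = column k S"
  have u: "u $ i = S $ i $ k" for i by (simp add: u_def column_def)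
  have uk: "S $ k $ j = u $ j" for j using u[of j] sij[of k j] by simp
  have Sk: "S *v axis k 1 = u" by (simp add: u_def matrix_vector_mult_basis)
  have ux: "(S *v x) $ k = u \<bullet> x" for x
    using symmetric_matrix_inner[OF sym, of "axis k 1" x] by (simp add: Sk inner_axis')
  have c: "u $ k = c" by (simp add: u c_def)
  have quad: "(x + s *\<^sub>R axis k 1) \<bullet> (S *v (x + s *\<^sub>R axis k 1)) = x \<bullet> (S *v x) + 2 * s * (u \<bullet> x) + s\<^sup>2 * c" for x s
  proof -
    have "S *v (x + s *\<^sub>R axis k 1) = S *v x + s *\<^sub>R u"
      by (simp add: matrix_vector_right_distrib matrix_vector_mult_scaleR Sk)
    moreover have "axis k 1 \<bullet> (S *v x) = u \<bullet> x" "axis k 1 \<bullet> u = c"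
      by (simp_all add: inner_axis' ux c)
    ultimately show ?thesis
      by (simp only: inner_add_left inner_add_right inner_scaleR_left inner_scaleR_right inner_commute[of x u])
         (simp add: power2_eq_square algebra_simps)
  qed
  have "c \<ge> 0" using psd[of "0 + 1 *\<^sub>R axis k 1"] unfolding quad by simp
  show ?case
  proof (cases "c = 0")
    case True
    have "u $ j = 0" for j
    proof (rule ccontr)
      assume "u $ j \<noteq> 0"
      define d where "d = S $ j $ j"
      have d: "axis j 1 \<bullet> (S *v axis j 1) = d"
        by (simp add: d_def inner_axis' matrix_vector_mult_basis column_def)
      have nonneg: "0 \<le> d + 2 * s * u $ j" for s
        using psd[of "axis j 1 + s *\<^sub>R axis k 1"] unfolding quad d True by (simp add: inner_axis)
      \<comment> \<open>An affine function of \<open>s\<close> that is bounded below has slope 0; at this \<open>s\<close> it would be \<open>-1\<close>.\<close>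
      have "d + 2 * (- (d + 1) / (2 * u $ j)) * u $ j = - 1"
        using \<open>u $ j \<noteq> 0\<close> by (simp add: field_simps)
      then show False using nonneg[of "- (d + 1) / (2 * u $ j)"] by linarith
    qed
    then have "S $ i $ j = 0" if "i \<notin> I" for i j
      using supp[of i j] that by (cases "i = k") (auto simp: uk)
    from insert.IH[OF sym psd this]
    obtain a :: "'d \<Rightarrow> real^'d" where a: "\<And>i j. S $ i $ j = (\<Sum>l\<in>I. a l $ i * a l $ j)" by blast
    have "S $ i $ j = (\<Sum>l\<in>insert k I. (a(k := 0)) l $ i * (a(k := 0)) l $ j)" for i j
      using insert.hyps by (simp add: a) (intro sum.cong, auto)
    then show ?thesis by blast
  next
    case False
    with \<open>c \<ge> 0\<close> have "c > 0" by simp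
    define T where "T = (\<chi> i j. S $ i $ j - u $ i * u $ j / c)"
    have Tx: "T *v x = S *v x - ((u \<bullet> x) / c) *\<^sub>R u" for x
      by (simp add: T_def vec_eq_iff matrix_vector_mult_def inner_vec_def sum_subtractf algebra_simps
          sum_distrib_left sum_divide_distrib)
    have "transpose T = T"
      by (simp add: T_def transpose_def vec_eq_iff sij mult.commute)
    moreover have "0 \<le> x \<bullet> (T *v x)" for x
    proof -
      have "x \<bullet> (T *v x) = x \<bullet> (S *v x) - (u \<bullet> x)\<^sup>2 / c"
        by (simp add: Tx inner_diff_right inner_commute[of x u] power2_eq_square)
      also have "\<dots> = x \<bullet> (S *v x) + 2 * (- (u \<bullet> x) / c) * (u \<bullet> x) + (- (u \<bullet> x) / c)\<^sup>2 * c"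
      proof -
        have "(- w / c)\<^sup>2 * c = w\<^sup>2 / c" "2 * (- w / c) * w = - 2 * (w\<^sup>2 / c)" for w
          using \<open>c > 0\<close> by (simp_all add: power2_eq_square)
        from this[of "u \<bullet> x"] show ?thesis by linarith
      qed
      finally show ?thesis using psd[of "x + (- (u \<bullet> x) / c) *\<^sub>R axis k 1"] unfolding quad by simp
    qed
    moreover have "T $ i $ j = 0" if "i \<notin> I" for i j
    proof (cases "i = k")
      case True
      then show ?thesis using \<open>c > 0\<close> by (simp add: T_def c uk)
    next
      case False
      then show ?thesis using supp[of i] that by (simp add: T_def u)
    qed
    ultimately obtain a :: "'d \<Rightarrow> real^'d" where a: "\<And>i j. T $ i $ j = (\<Sum>l\<in>I. a l $ i * a l $ j)"
      using insert.IH by blast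
    have "S $ i $ j = (\<Sum>l\<in>insert k I. (a(k := (1 / sqrt c) *\<^sub>R u)) l $ i * (a(k := (1 / sqrt c) *\<^sub>R u)) l $ j)" for i j
    proof -
      have "(\<Sum>l\<in>I. (a(k := (1 / sqrt c) *\<^sub>R u)) l $ i * (a(k := (1 / sqrt c) *\<^sub>R u)) l $ j) = T $ i $ j"
        unfolding a using insert.hyps by (intro sum.cong) auto
      then show ?thesis
        using insert.hyps \<open>c > 0\<close> by (simp add: T_def divide_simps)
    qed
    then show ?thesis by blast
  qed
qed

lemma psd_gram:
  fixes S :: "real^'d^'d"
  assumes "transpose S = S" "\<And>x. 0 \<le> x \<bullet> (S *v x)"
  shows "\<exists>a :: 'd \<Rightarrow> real^'d. \<forall>x. x \<bullet> (S *v x) = (\<Sum>l\<in>UNIV. (x \<bullet> a l)\<^sup>2)"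
proof -
  obtain a :: "'d \<Rightarrow> real^'d" where a: "\<And>i j. S $ i $ j = (\<Sum>l\<in>UNIV. a l $ i * a l $ j)"
    using psd_gram_supported[of UNIV S] assms by auto
  have "x \<bullet> (S *v x) = (\<Sum>l\<in>UNIV. (x \<bullet> a l)\<^sup>2)" for x
  proof -
    have "x \<bullet> (S *v x) = (\<Sum>i\<in>UNIV. \<Sum>j\<in>UNIV. \<Sum>l\<in>UNIV. (x $ i * a l $ i) * (x $ j * a l $ j))"
      by (simp add: inner_vec_def matrix_vector_mult_def a sum_distrib_left sum_distrib_right mult_ac)
    also have "\<dots> = (\<Sum>i\<in>UNIV. \<Sum>l\<in>UNIV. \<Sum>j\<in>UNIV. (x $ i * a l $ i) * (x $ j * a l $ j))"
      by (rule sum.cong[OF refl], rule sum.swap)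
    also have "\<dots> = (\<Sum>l\<in>UNIV. \<Sum>i\<in>UNIV. \<Sum>j\<in>UNIV. (x $ i * a l $ i) * (x $ j * a l $ j))"
      by (rule sum.swap)
    finally show ?thesis by (simp add: inner_vec_def power2_eq_square sum_product)
  qed
  then show ?thesis by blast
qed

text \<open>
  If \<open>S = \<Sum>\<^sub>l a\<^sub>l a\<^sub>l\<^sup>T\<close> and the \<open>\<omega>\<^sub>l\<close> are independent and standard normal, then \<open>Z = \<Sum>\<^sub>l \<omega>\<^sub>l a\<^sub>l\<close> has the law
  \<open>N(0, S)\<close>: the variable \<open>t \<bullet> Z\<close> is a sum of independent normal variables with variances \<open>(t \<bullet> a\<^sub>l)\<^sup>2\<close>.
\<close>

theorem centered_normal_exists:
  fixes S :: "real^'d^'d"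
  assumes sym: "transpose S = S" and psd: "\<And>x. 0 \<le> x \<bullet> (S *v x)"
  shows "\<exists>\<mu>. centered_normal S \<mu>"
proof -
  obtain a :: "'d \<Rightarrow> real^'d" where a: "\<And>x. x \<bullet> (S *v x) = (\<Sum>l\<in>UNIV. (x \<bullet> a l)\<^sup>2)"
    using psd_gram[OF assms] by blast
  interpret N: real_distribution std_normal_distribution by (rule real_dist_normal_dist)
  define P where "P = PiM (UNIV :: 'd set) (\<lambda>_. std_normal_distribution)"
  interpret P: product_prob_space "\<lambda>_. std_normal_distribution" "UNIV :: 'd set"
    by (intro product_prob_spaceI) (rule N.prob_space_axioms)
  interpret prob_space P unfolding P_def by (intro prob_space_PiM N.prob_space_axioms)
  have comp: "distr P borel (\<lambda>\<omega>. \<omega> l) = std_normal_distribution" for l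
  proof -
    have "distr P borel (\<lambda>\<omega>. \<omega> l) = distr P std_normal_distribution (\<lambda>\<omega>. \<omega> l)"
      by (rule distr_cong) auto
    then show ?thesis using P.PiM_component[of l] by (simp add: P_def)
  qed
  have sets_P [measurable_cong]: "sets P = sets (PiM UNIV (\<lambda>_. borel))"
    unfolding P_def by (rule sets_PiM_cong) auto
  have coord [measurable]: "(\<lambda>\<omega>. \<omega> l) \<in> borel_measurable P" for l
    by measurable
  have indep: "indep_vars (\<lambda>_. borel) (\<lambda>l \<omega>. \<omega> l) (UNIV :: 'd set)"
  proof (subst indep_vars_iff_distr_eq_PiM')
    have "distr P (PiM UNIV (\<lambda>_. borel)) (\<lambda>x. restrict x UNIV) = distr P P (\<lambda>x. x)"
      by (rule distr_cong) (auto simp: sets_P)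
    also have "\<dots> = PiM UNIV (\<lambda>l. distr P borel (\<lambda>\<omega>. \<omega> l))"
      unfolding comp by (simp add: distr_id P_def)
    finally show "distr P (PiM UNIV (\<lambda>_. borel)) (\<lambda>x. \<lambda>i\<in>UNIV. x i) = PiM UNIV (\<lambda>l. distr P borel (\<lambda>\<omega>. \<omega> l))" .
  qed auto
  have std: "distributed P lborel (\<lambda>\<omega>. \<omega> l) std_normal_density" for l
    unfolding distributed_def using comp[of l] by (auto cong: distr_cong simp: distr_cong[OF refl sets_lborel])
  define Z where "Z \<omega> = (\<Sum>l\<in>UNIV. \<omega> l *\<^sub>R a l)" for \<omega> :: "'d \<Rightarrow> real"
  have Z [measurable]: "Z \<in> borel_measurable P" unfolding Z_def by measurable
  have law: "let v = t \<bullet> (S *v t) in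
        (v = 0 \<and> distr (distr P borel Z) borel (\<lambda>x. t \<bullet> x) = return borel 0) \<or>
        (v > 0 \<and> distr (distr P borel Z) borel (\<lambda>x. t \<bullet> x) = density lborel (\<lambda>r. ennreal (normal_density 0 (sqrt v) r)))" for t
  proof -
    \<comment> \<open>Only nondegenerate summands have a normal density; without any, the law is the Dirac measure.\<close>
    define L where "L = {l. t \<bullet> a l \<noteq> 0}"
    have dd: "distr (distr P borel Z) borel (\<lambda>x. t \<bullet> x) = distr P borel (\<lambda>\<omega>. \<Sum>l\<in>L. (t \<bullet> a l) * \<omega> l)"
    proof -
      have "t \<bullet> Z \<omega> = (\<Sum>l\<in>L. (t \<bullet> a l) * \<omega> l)" for \<omega>
        unfolding Z_def inner_sum_right by (rule sum.mono_neutral_cong_right) (auto simp: L_def)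
      then show ?thesis by (simp add: distr_distr comp_def)
    qed
    have v: "t \<bullet> (S *v t) = (\<Sum>l\<in>L. (t \<bullet> a l)\<^sup>2)"
      unfolding a by (rule sum.mono_neutral_right) (auto simp: L_def)
    show ?thesis
    proof (cases "L = {}")
      case True
      have "distr P borel (\<lambda>\<omega>. 0 :: real) = return borel 0"
        by (rule measure_eqI) (auto simp: emeasure_distr emeasure_space_1 indicator_def split: if_splits)
      then show ?thesis unfolding dd v Let_def using True by simp
    next
      case False
      have "distributed P lborel (\<lambda>\<omega>. 0 + (t \<bullet> a l) * \<omega> l) (normal_density (0 + (t \<bullet> a l) * 0) (\<bar>t \<bullet> a l\<bar> * 1))"
        if "l \<in> L" for l
        using that by (intro normal_density_affine std) (auto simp: L_def)
      then have "distributed P lborel (\<lambda>\<omega>. (t \<bullet> a l) * \<omega> l) (normal_density 0 \<bar>t \<bullet> a l\<bar>)" if "l \<in> L" for l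
        using that by simp
      moreover have "indep_vars (\<lambda>_. borel) (\<lambda>l \<omega>. (t \<bullet> a l) * \<omega> l) L"
        by (rule indep_vars_compose2[OF indep_vars_subset[OF indep]]) auto
      ultimately have "distributed P lborel (\<lambda>\<omega>. \<Sum>l\<in>L. (t \<bullet> a l) * \<omega> l)
          (normal_density (\<Sum>l\<in>L. 0) (sqrt (\<Sum>l\<in>L. \<bar>t \<bullet> a l\<bar>\<^sup>2)))"
        using False by (intro sum_indep_normal) (auto simp: L_def)
      then have "distr P lborel (\<lambda>\<omega>. \<Sum>l\<in>L. (t \<bullet> a l) * \<omega> l) = density lborel (normal_density 0 (sqrt (\<Sum>l\<in>L. (t \<bullet> a l)\<^sup>2)))"
        by (simp add: distributed_def)
      moreover have "distr P lborel (\<lambda>\<omega>. \<Sum>l\<in>L. (t \<bullet> a l) * \<omega> l) = distr P borel (\<lambda>\<omega>. \<Sum>l\<in>L. (t \<bullet> a l) * \<omega> l)"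
        by (rule distr_cong) auto
      moreover have "(\<Sum>l\<in>L. (t \<bullet> a l)\<^sup>2) > 0"
        using False by (intro sum_pos) (auto simp: L_def)
      ultimately show ?thesis unfolding dd v Let_def by simp
    qed
  qed
  have "centered_normal S (distr P borel Z)"
    unfolding centered_normal_def using law sym by (auto intro: prob_space_distr)
  then show ?thesis by blast
qed

lemma char_normal:
  assumes "\<sigma> > 0"
  shows "char (density lborel (normal_density 0 \<sigma>)) s = exp (- ((\<sigma> * s)\<^sup>2) / 2)"
proof -
  interpret N: real_distribution std_normal_distribution by (rule real_dist_normal_dist)
  have "distributed std_normal_distribution lborel (\<lambda>x. x) std_normal_density"
    unfolding distributed_def by (auto intro!: distr_id2)
  then have "distributed std_normal_distribution lborel (\<lambda>x. 0 + \<sigma> * x) (normal_density (0 + \<sigma> * 0) (\<bar>\<sigma>\<bar> * 1))"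
    using assms by (intro N.normal_density_affine) auto
  then have "density lborel (normal_density 0 \<sigma>) = distr std_normal_distribution lborel (\<lambda>x. \<sigma> * x)"
    using assms by (simp add: distributed_def)
  also have "char \<dots> s = char std_normal_distribution (\<sigma> * s)"
    unfolding char_def by (subst integral_distr) (auto simp: mult_ac)
  finally show ?thesis by (simp add: char_std_normal_distribution)
qed

text \<open>
  The characteristic function at \<open>t\<close> is that of the law of \<open>t \<bullet> x\<close> at 1, which is Dirac or normal.
\<close>

lemma centered_normal_char:
  assumes "centered_normal S \<mu>"
  shows "(\<integral>x. iexp (t \<bullet> x) \<partial>\<mu>) = exp (- (t \<bullet> (S *v t)) / 2)"
proof -
  have [measurable_cong]: "sets \<mu> = sets borel" using assms by (simp add: centered_normal_def)
  have c: "char (distr \<mu> borel (\<lambda>x. t \<bullet> x)) 1 = (\<integral>x. iexp (t \<bullet> x) \<partial>\<mu>)"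
    unfolding char_def by (subst integral_distr) auto
  define v where "v = t \<bullet> (S *v t)"
  have "v = 0 \<and> distr \<mu> borel (\<lambda>x. t \<bullet> x) = return borel 0 \<or>
      v > 0 \<and> distr \<mu> borel (\<lambda>x. t \<bullet> x) = density lborel (normal_density 0 (sqrt v))"
    using assms by (simp add: centered_normal_def Let_def v_def)
  then have "char (distr \<mu> borel (\<lambda>x. t \<bullet> x)) 1 = exp (- v / 2)"
  proof (elim disjE conjE)
    assume "v = 0" "distr \<mu> borel (\<lambda>x. t \<bullet> x) = return borel 0"
    then show ?thesis by (simp add: char_def integral_return)
  next
    assume "v > 0" "distr \<mu> borel (\<lambda>x. t \<bullet> x) = density lborel (normal_density 0 (sqrt v))"
    then show ?thesis using char_normal[of "sqrt v" 1] by simp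
  qed
  then show ?thesis by (simp add: c v_def)
qed

section \<open>Asymptotics of smooth functions of sample means\<close>

lemma (in prob_space) indep_vars_reindex_inj:
  assumes indep: "indep_vars (\<lambda>_. N) Y J" and f: "inj_on f I" "f ` I \<subseteq> J"
  shows "indep_vars (\<lambda>_. N) (\<lambda>i. Y (f i)) I"
  unfolding indep_vars_def2
proof (intro conjI ballI)
  show "random_variable N (Y (f i))" if "i \<in> I" for i
    using indep f that by (auto simp: indep_vars_def2)
  have sets: "indep_sets (\<lambda>i. {Y i -` A \<inter> space M |A. A \<in> sets N}) J"
    using indep by (simp add: indep_vars_def2)
  show "indep_sets (\<lambda>i. {Y (f i) -` A \<inter> space M |A. A \<in> sets N}) I"
  proof (rule indep_setsI)
    show "{Y (f i) -` A \<inter> space M |A. A \<in> sets N} \<subseteq> events" if "i \<in> I" for i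
      using sets f that unfolding indep_sets_def by blast
    fix A K assume K: "K \<noteq> {}" "K \<subseteq> I" "finite K"
      and A: "\<forall>j\<in>K. A j \<in> {Y (f j) -` A \<inter> space M |A. A \<in> sets N}"
    have inj: "inj_on f K" using f(1) K(2) inj_on_subset by blast
    define B where "B j = A (the_inv_into K f j)" for j
    have B: "B (f k) = A k" if "k \<in> K" for k
      using that inj by (simp add: B_def the_inv_into_f_f)
    have "prob (\<Inter>j\<in>f ` K. B j) = (\<Prod>j\<in>f ` K. prob (B j))"
      using K f A by (intro indep_setsD[OF sets]) (auto simp: B)
    then show "prob (\<Inter>j\<in>K. A j) = (\<Prod>j\<in>K. prob (A j))"
      by (simp add: prod.reindex[OF inj] B cong: INF_cong prod.cong)
  qed
qed

text \<open>
  A sample is indexed from 1, so moments refer to the common law \<open>Q\<close> rather than to one of the variables.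
\<close>

locale centered_sample = prob_space M for M :: "'a measure" +
  fixes Y :: "nat \<Rightarrow> 'a \<Rightarrow> real^'m" and Q :: "(real^'m) measure" and V :: "real^'m^'m"
  assumes indep: "indep_vars (\<lambda>_. borel) Y {1..}"
    and ident: "\<And>n. n \<ge> 1 \<Longrightarrow> distr M borel (Y n) = Q"
    and square_integrable: "integrable Q (\<lambda>x. (norm x)\<^sup>2)"
    and centered: "(\<integral>x. x \<partial>Q) = 0"
    and V_eq: "V = (\<chi> i j. \<integral>x. x $ i * x $ j \<partial>Q)"
begin

lemma Y_measurable: "n \<ge> 1 \<Longrightarrow> Y n \<in> borel_measurable M"
  using indep by (auto simp: indep_vars_def2)

lemma sets_Q [measurable_cong]: "sets Q = sets borel"
  using ident[of 1] by (metis order_refl sets_distr)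

lemma prob_space_Q: "prob_space Q"
  using ident[of 1] Y_measurable[of 1] prob_space_distr by (metis order_refl)

lemma square_integrable_inner: "integrable Q (\<lambda>x. (t \<bullet> x)\<^sup>2)"
proof (rule Bochner_Integration.integrable_bound)
  show "integrable Q (\<lambda>x. (norm t)\<^sup>2 * (norm x)\<^sup>2)"
    using square_integrable by simp
  show "AE x in Q. norm ((t \<bullet> x)\<^sup>2) \<le> norm ((norm t)\<^sup>2 * (norm x)\<^sup>2)"
    using power_mono[OF Cauchy_Schwarz_ineq2, of t _ 2] by (simp add: power_mult_distrib)
qed simp

lemma integrable_inner: "integrable Q (\<lambda>x. t \<bullet> x)"
proof -
  interpret Q: prob_space Q by (rule prob_space_Q)
  show ?thesis by (rule Q.square_integrable_imp_integrable[OF _ square_integrable_inner]) simp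
qed

lemma integrable_id: "integrable Q (\<lambda>x. x)"
proof -
  interpret Q: prob_space Q by (rule prob_space_Q)
  have "integrable Q (\<lambda>x. norm x)"
    by (rule Q.square_integrable_imp_integrable[OF _ square_integrable]) simp
  then show ?thesis by (simp add: integrable_norm_iff)
qed

lemma mean_inner: "(\<integral>x. t \<bullet> x \<partial>Q) = 0"
  using integrable_id centered by simp

lemma quadratic_form: "(\<integral>x. (t \<bullet> x)\<^sup>2 \<partial>Q) = t \<bullet> (V *v t)"
proof -
  have int: "integrable Q (\<lambda>x. x $ i * x $ j)" for i j
  proof (rule Bochner_Integration.integrable_bound)
    have "\<bar>x $ i\<bar> * \<bar>x $ j\<bar> \<le> norm x * norm x" for x :: "real^'m"
      by (intro mult_mono component_le_norm_cart) auto
    then show "AE x in Q. norm (x $ i * x $ j) \<le> norm ((norm x)\<^sup>2)"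
      by (simp add: abs_mult power2_eq_square)
  qed (use square_integrable in auto)
  have "(\<integral>x. (t \<bullet> x)\<^sup>2 \<partial>Q) = (\<integral>x. (\<Sum>i\<in>UNIV. \<Sum>j\<in>UNIV. (t $ i * t $ j) * (x $ i * x $ j)) \<partial>Q)"
    by (intro Bochner_Integration.integral_cong)
       (simp_all add: inner_vec_def power2_eq_square sum_product mult_ac)
  also have "\<dots> = (\<Sum>i\<in>UNIV. \<Sum>j\<in>UNIV. (t $ i * t $ j) * V $ i $ j)"
    using int by (subst Bochner_Integration.integral_sum; (subst Bochner_Integration.integral_sum)?)
      (auto simp: V_eq)
  finally show ?thesis
    by (simp add: inner_vec_def matrix_vector_mult_def sum_distrib_left mult_ac)
qed

lemma expectation_Y:
  fixes f :: "real^'m \<Rightarrow> 'c::{banach,second_countable_topology}"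
  assumes "n \<ge> 1" "f \<in> borel_measurable borel"
  shows "(\<integral>\<omega>. f (Y n \<omega>) \<partial>M) = (\<integral>x. f x \<partial>Q)" "integrable M (\<lambda>\<omega>. f (Y n \<omega>)) \<longleftrightarrow> integrable Q f"
  using ident[OF assms(1)] Y_measurable[OF assms(1)] assms(2)
  by (metis integral_distr, metis integrable_distr_eq)

definition partial_sum :: "nat \<Rightarrow> 'a \<Rightarrow> real^'m" where "partial_sum N \<omega> = (\<Sum>n=1..N. Y n \<omega>)"

lemma partial_sum_measurable [measurable]: "partial_sum N \<in> borel_measurable M"
  unfolding partial_sum_def[abs_def] using Y_measurable by (intro borel_measurable_sum) auto

text \<open>
  The mixed terms of the square have expectation 0, by independence and since the variables are centered.
\<close>

lemma second_moment_inner: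
  "integrable M (\<lambda>\<omega>. (t \<bullet> partial_sum N \<omega>)\<^sup>2)" "(\<integral>\<omega>. (t \<bullet> partial_sum N \<omega>)\<^sup>2 \<partial>M) = real N * (t \<bullet> (V *v t))"
proof -
  have "integrable M (\<lambda>\<omega>. (t \<bullet> Y n \<omega>) * (t \<bullet> Y m \<omega>)) \<and>
     (\<integral>\<omega>. (t \<bullet> Y n \<omega>) * (t \<bullet> Y m \<omega>) \<partial>M) = (if n = m then t \<bullet> (V *v t) else 0)"
    if "n \<in> {1..N}" "m \<in> {1..N}" for n m
  proof (cases "n = m")
    case True
    then show ?thesis
      using that expectation_Y[of n "\<lambda>x. (t \<bullet> x)\<^sup>2"] square_integrable_inner quadratic_form
      by (simp add: power2_eq_square)
  next
    case False
    have ind: "indep_vars (\<lambda>_. borel) (\<lambda>n \<omega>. t \<bullet> Y n \<omega>) {n, m}"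
      using that by (intro indep_vars_compose2[OF indep_vars_subset[OF indep]]) auto
    have int: "integrable M (\<lambda>\<omega>. t \<bullet> Y k \<omega>)" "(\<integral>\<omega>. t \<bullet> Y k \<omega> \<partial>M) = 0" if "k \<in> {n, m}" for k
      using that \<open>n \<in> _\<close> \<open>m \<in> _\<close> expectation_Y[of k "\<lambda>x. t \<bullet> x"] integrable_inner[of t] mean_inner[of t] by auto
    show ?thesis
      using indep_vars_lebesgue_integral[OF _ ind int(1)] indep_vars_integrable[OF _ ind int(1)] False int
      by simp
  qed
  note pair = this
  have sq: "(t \<bullet> partial_sum N \<omega>)\<^sup>2 = (\<Sum>n=1..N. \<Sum>m=1..N. (t \<bullet> Y n \<omega>) * (t \<bullet> Y m \<omega>))" for \<omega>
    by (simp add: partial_sum_def inner_sum_right power2_eq_square sum_product)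
  show "integrable M (\<lambda>\<omega>. (t \<bullet> partial_sum N \<omega>)\<^sup>2)"
    unfolding sq using pair by (intro Bochner_Integration.integrable_sum) auto
  have "(\<integral>\<omega>. (t \<bullet> partial_sum N \<omega>)\<^sup>2 \<partial>M) = (\<Sum>n=1..N. \<Sum>m=1..N. \<integral>\<omega>. (t \<bullet> Y n \<omega>) * (t \<bullet> Y m \<omega>) \<partial>M)"
    unfolding sq using pair
    by (subst Bochner_Integration.integral_sum)
       (auto intro!: sum.cong Bochner_Integration.integral_sum Bochner_Integration.integrable_sum)
  also have "\<dots> = (\<Sum>n=1..N. \<Sum>m=1..N. if n = m then t \<bullet> (V *v t) else 0)"
    using pair by (intro sum.cong) auto
  also have "\<dots> = real N * (t \<bullet> (V *v t))" by simp
  finally show "(\<integral>\<omega>. (t \<bullet> partial_sum N \<omega>)\<^sup>2 \<partial>M) = real N * (t \<bullet> (V *v t))" .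
qed

text \<open>
  The trace of \<open>V\<close>, which is the second moment of the norm under \<open>Q\<close>.
\<close>

definition total_variance :: real where "total_variance = (\<Sum>b\<in>Basis. b \<bullet> (V *v b))"

lemma second_moment:
  "integrable M (\<lambda>\<omega>. (norm (partial_sum N \<omega>))\<^sup>2)" "(\<integral>\<omega>. (norm (partial_sum N \<omega>))\<^sup>2 \<partial>M) = real N * total_variance"
proof -
  have n: "(norm (partial_sum N \<omega>))\<^sup>2 = (\<Sum>b\<in>Basis. (b \<bullet> partial_sum N \<omega>)\<^sup>2)" for \<omega>
    unfolding power2_norm_eq_inner by (subst euclidean_inner) (simp add: power2_eq_square inner_commute)
  show "integrable M (\<lambda>\<omega>. (norm (partial_sum N \<omega>))\<^sup>2)"
    unfolding n using second_moment_inner(1) by (intro Bochner_Integration.integrable_sum)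
  show "(\<integral>\<omega>. (norm (partial_sum N \<omega>))\<^sup>2 \<partial>M) = real N * total_variance"
    unfolding n using second_moment_inner by (simp add: total_variance_def sum_distrib_left)
qed

lemma total_variance_nonneg: "total_variance \<ge> 0"
proof -
  have "0 \<le> (\<integral>\<omega>. (norm (partial_sum 1 \<omega>))\<^sup>2 \<partial>M)" by (rule Bochner_Integration.integral_nonneg) simp
  then show ?thesis by (simp add: second_moment(2))
qed

lemma V_psd: "0 \<le> t \<bullet> (V *v t)"
  unfolding quadratic_form[symmetric] by simp

lemma V_sym: "transpose V = V"
  by (simp add: V_eq transpose_def vec_eq_iff mult.commute)

text \<open>
  This is the central limit theorem on the line, applied to \<open>t \<bullet> Y n\<close> normalized by its standard deviation
  \<open>\<sigma>\<close>, with the characteristic function evaluated at \<open>\<sigma>\<close>. If the variance vanishes, then \<open>t \<bullet> Y n = 0\<close>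
  almost surely.
\<close>

lemma clt_char: "(\<lambda>N. \<integral>\<omega>. iexp ((t \<bullet> partial_sum N \<omega>) / sqrt N) \<partial>M) \<longlonglongrightarrow> exp (- (t \<bullet> (V *v t)) / 2)"
proof (cases "t \<bullet> (V *v t) = 0")
  case True
  have "(\<integral>\<omega>. iexp ((t \<bullet> partial_sum N \<omega>) / sqrt N) \<partial>M) = 1" for N
  proof -
    have "AE \<omega> in M. (t \<bullet> partial_sum N \<omega>)\<^sup>2 = 0"
      using second_moment_inner[of t N] True integral_nonneg_eq_0_iff_AE[of M "\<lambda>\<omega>. (t \<bullet> partial_sum N \<omega>)\<^sup>2"] by simp
    then have "(\<integral>\<omega>. iexp ((t \<bullet> partial_sum N \<omega>) / sqrt N) \<partial>M) = (\<integral>\<omega>. 1 \<partial>M)"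
      by (intro integral_cong_AE) auto
    then show ?thesis by (simp add: prob_space)
  qed
  then show ?thesis using True by simp
next
  case False
  define \<sigma> where "\<sigma> = sqrt (t \<bullet> (V *v t))"
  have \<sigma>: "\<sigma> > 0" "\<sigma>\<^sup>2 = t \<bullet> (V *v t)" using False V_psd[of t] by (auto simp: \<sigma>_def)
  define X where "X n \<omega> = t \<bullet> Y (Suc n) \<omega>" for n \<omega>
  have "weak_conv_m (\<lambda>n. distr M borel (\<lambda>\<omega>. (\<Sum>i<n. X i \<omega>) / sqrt (n * \<sigma>\<^sup>2))) std_normal_distribution"
  proof (rule central_limit_theorem_zero_mean[OF _ _ \<sigma>(1)])
    have "indep_vars (\<lambda>_. borel) (\<lambda>n. Y (Suc n)) UNIV"
      by (rule indep_vars_reindex_inj[OF indep]) auto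
    then show "indep_vars (\<lambda>_. borel) X UNIV"
      unfolding X_def[abs_def] by (rule indep_vars_compose2) auto
    show e: "expectation (X n) = 0" for n
      using expectation_Y(1)[of "Suc n" "\<lambda>x. t \<bullet> x"] mean_inner by (simp add: X_def[abs_def])
    show "integrable M (\<lambda>x. (X n x)\<^sup>2)" for n
      using expectation_Y(2)[of "Suc n" "\<lambda>x. (t \<bullet> x)\<^sup>2"] square_integrable_inner by (simp add: X_def)
    show "variance (X n) = \<sigma>\<^sup>2" for n
      using expectation_Y(1)[of "Suc n" "\<lambda>x. (t \<bullet> x)\<^sup>2"] quadratic_form \<sigma> e by (simp add: X_def)
    show "distr M borel (X n) = distr Q borel (\<lambda>x. t \<bullet> x)" for n
    proof -
      have "distr Q borel (\<lambda>x. t \<bullet> x) = distr (distr M borel (Y (Suc n))) borel (\<lambda>x. t \<bullet> x)"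
        by (simp add: ident)
      also have "\<dots> = distr M borel (X n)"
        using Y_measurable[of "Suc n"] by (subst distr_distr) (auto simp: comp_def X_def[abs_def])
      finally show ?thesis by simp
    qed
  qed
  moreover have rd: "real_distribution (distr M borel (\<lambda>\<omega>. (\<Sum>i<n. X i \<omega>) / sqrt (n * \<sigma>\<^sup>2)))" for n
    using Y_measurable by (intro real_distribution_distr) (auto simp: X_def)
  ultimately have "(\<lambda>n. char (distr M borel (\<lambda>\<omega>. (\<Sum>i<n. X i \<omega>) / sqrt (n * \<sigma>\<^sup>2))) \<sigma>) \<longlonglongrightarrow> char std_normal_distribution \<sigma>"
    by (intro levy_continuity1 real_dist_normal_dist)
  moreover have "char (distr M borel (\<lambda>\<omega>. (\<Sum>i<n. X i \<omega>) / sqrt (n * \<sigma>\<^sup>2))) \<sigma> = (\<integral>\<omega>. iexp ((t \<bullet> partial_sum n \<omega>) / sqrt n) \<partial>M)" for n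
  proof -
    have "\<sigma> * ((\<Sum>i<n. X i \<omega>) / sqrt (n * \<sigma>\<^sup>2)) = (t \<bullet> partial_sum n \<omega>) / sqrt n" for \<omega>
      using \<sigma>(1) by (simp add: X_def partial_sum_def inner_sum_right real_sqrt_mult sum.atLeast1_atMost_eq)
    moreover have "(\<lambda>\<omega>. (\<Sum>i<n. X i \<omega>) / sqrt (n * \<sigma>\<^sup>2)) \<in> borel_measurable M"
      using Y_measurable by (auto simp: X_def)
    ultimately show ?thesis unfolding char_def by (subst integral_distr) simp_all
  qed
  ultimately show ?thesis
    by (simp add: char_std_normal_distribution \<sigma>(2))
qed

lemma norm_iexp_diff: "norm (iexp a - iexp b) \<le> \<bar>a - b\<bar>"
proof -
  have "iexp a - iexp b = iexp b * (iexp (a - b) - 1)"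
    by (simp add: exp_diff right_diff_distrib)
  then show ?thesis
    using iexp_approx1[of "a - b" 0] by (simp add: norm_mult)
qed

text \<open>
  The sample mean of variables with mean \<open>m\<close> and centered versions \<open>Y n\<close> is \<open>average N\<close>, and \<open>scaled_error N\<close>
  is the normalized error of \<open>g\<close> at the sample mean, which is compared with its linearization
  \<open>G *v partial_sum N / sqrt N\<close>.
\<close>

context
  fixes m :: "real^'m" and g :: "real^'m \<Rightarrow> real^'d" and G :: "real^'m^'d"
  assumes g_meas: "g \<in> borel_measurable borel"
    and g_deriv: "(g has_derivative (\<lambda>u. G *v u)) (at m)"
begin

definition average :: "nat \<Rightarrow> 'a \<Rightarrow> real^'m" where "average N \<omega> = m + (1 / real N) *\<^sub>R partial_sum N \<omega>"

definition scaled_error :: "nat \<Rightarrow> 'a \<Rightarrow> real^'d" where "scaled_error N \<omega> = sqrt (real N) *\<^sub>R (g (average N \<omega>) - g m)"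

lemma average_measurable [measurable]: "average N \<in> borel_measurable M"
  unfolding average_def[abs_def] by measurable

lemma g_average_measurable [measurable]: "(\<lambda>\<omega>. g (average N \<omega>)) \<in> borel_measurable M"
  by (rule measurable_compose[OF average_measurable g_meas])

lemma scaled_error_measurable [measurable]: "scaled_error N \<in> borel_measurable M"
  unfolding scaled_error_def[abs_def] by measurable

lemma linearization_error:
  assumes "e > 0"
  obtains d where "d > 0" "\<And>N \<omega>. N \<ge> 1 \<Longrightarrow> norm (partial_sum N \<omega>) < real N * d \<Longrightarrow>
     norm (scaled_error N \<omega> - (1 / sqrt N) *\<^sub>R (G *v partial_sum N \<omega>)) \<le> e * (norm (partial_sum N \<omega>) / sqrt N)"
proof -
  obtain d where d: "d > 0" "\<And>y. norm (y - m) < d \<Longrightarrow> norm (g y - g m - G *v (y - m)) \<le> e * norm (y - m)"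
    using g_deriv assms unfolding has_derivative_at_alt by meson
  show thesis
  proof (rule that[OF d(1)])
    fix N :: nat and \<omega> assume N: "N \<ge> 1" and near: "norm (partial_sum N \<omega>) < real N * d"
    have "norm (average N \<omega> - m) < d"
      using N near by (simp add: average_def field_simps)
    from d(2)[OF this]
    have le: "norm (g (average N \<omega>) - g m - G *v (average N \<omega> - m)) \<le> e * (norm (partial_sum N \<omega>) / real N)"
      using N by (simp add: average_def)
    have "(1 / sqrt N) *\<^sub>R (G *v partial_sum N \<omega>) = sqrt N *\<^sub>R (G *v (average N \<omega> - m))"
      using N by (simp add: average_def matrix_vector_mult_scaleR real_div_sqrt field_simps)
    then have "scaled_error N \<omega> - (1 / sqrt N) *\<^sub>R (G *v partial_sum N \<omega>) = sqrt N *\<^sub>R (g (average N \<omega>) - g m - G *v (average N \<omega> - m))"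
      by (simp add: scaled_error_def scaleR_diff_right)
    then have "norm (scaled_error N \<omega> - (1 / sqrt N) *\<^sub>R (G *v partial_sum N \<omega>)) \<le> sqrt N * (e * (norm (partial_sum N \<omega>) / real N))"
      using mult_left_mono[OF le, of "sqrt N"] by simp
    also have "\<dots> = e * (norm (partial_sum N \<omega>) / sqrt N)"
      using N by (simp add: field_simps)
    finally show "norm (scaled_error N \<omega> - (1 / sqrt N) *\<^sub>R (G *v partial_sum N \<omega>)) \<le> e * (norm (partial_sum N \<omega>) / sqrt N)" .
  qed
qed

text \<open>
  Where the sample mean is at distance less than \<open>d\<close> from \<open>m\<close>, differentiability bounds the error of the
  linearization by \<open>e * norm (partial_sum N) / sqrt N\<close>, whose expectation is at most a constant multiple of \<open>e\<close>,
  because \<open>norm (partial_sum N)\<^sup>2\<close> has expectation \<open>N\<close> times the total variance. Elsewhere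
  \<open>(norm (partial_sum N) / (N * d))\<^sup>2 \<ge> 1\<close>, and this square has expectation of order \<open>1 / N\<close> (Chebyshev). So both
  regions are covered by one integrable bound \<open>?b\<close> on the difference of the exponentials.
\<close>

lemma char_linearization:
  "(\<lambda>N. (\<integral>\<omega>. iexp (t \<bullet> scaled_error N \<omega>) \<partial>M) - (\<integral>\<omega>. iexp (((transpose G *v t) \<bullet> partial_sum N \<omega>) / sqrt N) \<partial>M)) \<longlonglongrightarrow> 0"
proof (rule LIMSEQ_I)
  fix r :: real assume r: "r > 0"
  \<comment> \<open>This makes the first term of the bound, \<open>norm t * e * (1 + total_variance)\<close>, at most \<open>r / 2\<close>.\<close>
  define e where "e = r / (2 * (norm t + 1) * (total_variance + 1))"
  have "norm t + 1 > 0" "total_variance + 1 > 0" using total_variance_nonneg by (simp_all add: add_nonneg_pos)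
  then have e: "e > 0" using r by (simp add: e_def)
  obtain d where d: "d > 0" and lin: "\<And>N \<omega>. N \<ge> 1 \<Longrightarrow> norm (partial_sum N \<omega>) < real N * d \<Longrightarrow>
     norm (scaled_error N \<omega> - (1 / sqrt N) *\<^sub>R (G *v partial_sum N \<omega>)) \<le> e * (norm (partial_sum N \<omega>) / sqrt N)"
    using linearization_error[OF e] by blast
  let ?lin = "\<lambda>N \<omega>. ((transpose G *v t) \<bullet> partial_sum N \<omega>) / sqrt N"
  let ?b = "\<lambda>N \<omega>. norm t * e * (1 + (norm (partial_sum N \<omega>))\<^sup>2 / N) + 2 / (real N * d)\<^sup>2 * (norm (partial_sum N \<omega>))\<^sup>2"
  have bound: "norm (iexp (t \<bullet> scaled_error N \<omega>) - iexp (?lin N \<omega>)) \<le> ?b N \<omega>" if N: "N \<ge> 1" for N \<omega>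
  proof (cases "norm (partial_sum N \<omega>) < real N * d")
    case True
    have lin_eq: "?lin N \<omega> = t \<bullet> ((1 / sqrt N) *\<^sub>R (G *v partial_sum N \<omega>))"
      by (simp add: dot_lmul_matrix[symmetric])
    have "norm (iexp (t \<bullet> scaled_error N \<omega>) - iexp (?lin N \<omega>)) \<le> \<bar>t \<bullet> scaled_error N \<omega> - ?lin N \<omega>\<bar>"
      by (rule norm_iexp_diff)
    also have "t \<bullet> scaled_error N \<omega> - ?lin N \<omega> = t \<bullet> (scaled_error N \<omega> - (1 / sqrt N) *\<^sub>R (G *v partial_sum N \<omega>))"
      by (simp only: inner_diff_right lin_eq)
    also have "\<bar>t \<bullet> (scaled_error N \<omega> - (1 / sqrt N) *\<^sub>R (G *v partial_sum N \<omega>))\<bar> \<le> norm t * (e * (norm (partial_sum N \<omega>) / sqrt N))"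
      using lin[OF N True] by (meson Cauchy_Schwarz_ineq2 mult_left_mono norm_ge_zero order_trans)
    also have "norm (partial_sum N \<omega>) / sqrt N \<le> 1 + (norm (partial_sum N \<omega>))\<^sup>2 / N"
    proof -
      have "x \<le> 1 + x\<^sup>2" if "x \<ge> 0" for x :: real
        using that zero_le_power2[of "x - 1"] by (simp add: power2_diff)
      from this[of "norm (partial_sum N \<omega>) / sqrt N"] show ?thesis by (simp add: power_divide)
    qed
    finally have "norm (iexp (t \<bullet> scaled_error N \<omega>) - iexp (?lin N \<omega>)) \<le> norm t * e * (1 + (norm (partial_sum N \<omega>))\<^sup>2 / N)"
      using e by (simp add: mult.assoc mult_left_mono)
    moreover have "0 \<le> 2 / (real N * d)\<^sup>2 * (norm (partial_sum N \<omega>))\<^sup>2" by simp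
    ultimately show ?thesis by linarith
  next
    case False
    have "norm (iexp (t \<bullet> scaled_error N \<omega>) - iexp (?lin N \<omega>)) \<le> 2"
      using norm_triangle_ineq4[of "iexp (t \<bullet> scaled_error N \<omega>)" "iexp (?lin N \<omega>)"] by simp
    also have "2 \<le> 2 / (real N * d)\<^sup>2 * (norm (partial_sum N \<omega>))\<^sup>2"
      using False N d power_mono[of "real N * d" "norm (partial_sum N \<omega>)" 2] by (simp add: field_simps)
    finally have "norm (iexp (t \<bullet> scaled_error N \<omega>) - iexp (?lin N \<omega>)) \<le> 2 / (real N * d)\<^sup>2 * (norm (partial_sum N \<omega>))\<^sup>2" .
    moreover have "0 \<le> norm t * e * (1 + (norm (partial_sum N \<omega>))\<^sup>2 / N)" using e by simp
    ultimately show ?thesis by linarith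
  qed
  have iexp_int: "integrable M (\<lambda>\<omega>. iexp (f \<omega>))" if "f \<in> borel_measurable M" for f
    using that by (intro integrable_const_bound[where B=1]) auto
  have est: "norm ((\<integral>\<omega>. iexp (t \<bullet> scaled_error N \<omega>) \<partial>M) - (\<integral>\<omega>. iexp (?lin N \<omega>) \<partial>M)) \<le> norm t * e * (1 + total_variance) + 2 * total_variance / d\<^sup>2 * (1 / N)"
    if N: "N \<ge> 1" for N
  proof -
    have int_b: "integrable M (?b N)"
      using second_moment(1) by (intro Bochner_Integration.integrable_add integrable_mult_right) auto
    have "(\<integral>\<omega>. iexp (t \<bullet> scaled_error N \<omega>) \<partial>M) - (\<integral>\<omega>. iexp (?lin N \<omega>) \<partial>M) = (\<integral>\<omega>. iexp (t \<bullet> scaled_error N \<omega>) - iexp (?lin N \<omega>) \<partial>M)"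
      by (intro Bochner_Integration.integral_diff[symmetric] iexp_int) auto
    also have "norm \<dots> \<le> (\<integral>\<omega>. norm (iexp (t \<bullet> scaled_error N \<omega>) - iexp (?lin N \<omega>)) \<partial>M)"
      by (rule integral_norm_bound)
    also have "\<dots> \<le> (\<integral>\<omega>. ?b N \<omega> \<partial>M)"
      by (intro integral_mono int_b bound[OF N] integrable_norm Bochner_Integration.integrable_diff iexp_int) auto
    also have "\<dots> = norm t * e * (1 + total_variance) + 2 / (real N * d)\<^sup>2 * (real N * total_variance)"
      using second_moment[of N] N by (simp add: prob_space)
    also have "2 / (real N * d)\<^sup>2 * (real N * total_variance) = 2 * total_variance / d\<^sup>2 * (1 / N)"
      using N d by (simp add: power2_eq_square field_simps)
    finally show ?thesis .
  qed
  have "norm t * e * (1 + total_variance) = r / 2 * (norm t / (norm t + 1))"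
  proof -
    have "x * (r / (2 * a * b)) * b = r / 2 * (x / a)" if "b \<noteq> 0" for x a b :: real
      using that by simp
    from this[of "total_variance + 1" "norm t" "norm t + 1"] show ?thesis
      using \<open>total_variance + 1 > 0\<close> by (simp add: e_def add.commute)
  qed
  also have "\<dots> \<le> r / 2 * 1"
    using r \<open>norm t + 1 > 0\<close> by (intro mult_left_mono) (simp_all add: pos_divide_le_eq)
  finally have small: "norm t * e * (1 + total_variance) \<le> r / 2" by simp
  have "(\<lambda>N. 2 * total_variance / d\<^sup>2 * (1 / real N)) \<longlonglongrightarrow> 2 * total_variance / d\<^sup>2 * 0"
    by (intro tendsto_mult tendsto_const lim_1_over_n)
  then have "eventually (\<lambda>N. 2 * total_variance / d\<^sup>2 * (1 / real N) < r / 2) sequentially"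
    using r by (intro order_tendstoD(2)) auto
  then have "eventually (\<lambda>N. norm ((\<integral>\<omega>. iexp (t \<bullet> scaled_error N \<omega>) \<partial>M) - (\<integral>\<omega>. iexp (?lin N \<omega>) \<partial>M) - 0) < r) sequentially"
    using eventually_ge_at_top[of 1]
  proof eventually_elim
    case (elim N)
    then show ?case using est[of N] small by simp
  qed
  then show "\<exists>no. \<forall>n\<ge>no. norm ((\<integral>\<omega>. iexp (t \<bullet> scaled_error n \<omega>) \<partial>M) - (\<integral>\<omega>. iexp (?lin n \<omega>) \<partial>M) - 0) < r"
    by (simp add: eventually_sequentially)
qed

text \<open>
  The characteristic functions of the scaled errors have the same limit as those of their linearizations,
  whose projection to \<open>t\<close> is the projection of the normalized partial sum to \<open>G\<^sup>T t\<close>; by the central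
  limit theorem this limit is \<open>exp (- (t \<bullet> G V G\<^sup>T t) / 2)\<close>, the characteristic function of \<open>N(0, G V G\<^sup>T)\<close>.
\<close>

theorem delta_method:
  "\<exists>\<mu>. centered_normal (G ** V ** transpose G) \<mu> \<and> weakly_converges (\<lambda>N. distr M borel (scaled_error N)) \<mu>"
proof -
  let ?\<Sigma> = "G ** V ** transpose G"
  have quad: "t \<bullet> (?\<Sigma> *v t) = (transpose G *v t) \<bullet> (V *v (transpose G *v t))" for t
    by (simp add: matrix_vector_mul_assoc[symmetric] dot_lmul_matrix[symmetric])
  have "transpose ?\<Sigma> = ?\<Sigma>"
    by (simp add: matrix_transpose_mul V_sym matrix_mul_assoc)
  moreover have "0 \<le> t \<bullet> (?\<Sigma> *v t)" for t
    unfolding quad by (rule V_psd)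
  ultimately obtain \<mu> where \<mu>: "centered_normal ?\<Sigma> \<mu>"
    using centered_normal_exists by blast
  have "weakly_converges (\<lambda>N. distr M borel (scaled_error N)) \<mu>"
  proof (rule levy_continuity_euclidean)
    show "prob_space (distr M borel (scaled_error N))" for N by (rule prob_space_distr) simp
    show "prob_space \<mu>" "sets \<mu> = sets borel" using \<mu> by (auto simp: centered_normal_def)
    fix t :: "real^'d"
    have "(\<integral>x. iexp (t \<bullet> x) \<partial>distr M borel (scaled_error N)) = (\<integral>\<omega>. iexp (t \<bullet> scaled_error N \<omega>) \<partial>M)" for N
      by (subst integral_distr) auto
    moreover have "(\<lambda>N. \<integral>\<omega>. iexp (t \<bullet> scaled_error N \<omega>) \<partial>M) \<longlonglongrightarrow> exp (- (t \<bullet> (?\<Sigma> *v t)) / 2)"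
      using tendsto_add[OF char_linearization[of t] clt_char[of "transpose G *v t"]] by (simp add: quad)
    ultimately show "(\<lambda>N. \<integral>x. iexp (t \<bullet> x) \<partial>distr M borel (scaled_error N)) \<longlonglongrightarrow> (\<integral>x. iexp (t \<bullet> x) \<partial>\<mu>)"
      by (simp add: centered_normal_char[OF \<mu>])
  qed simp
  with \<mu> show ?thesis by blast
qed

text \<open>
  By continuity of \<open>g\<close> at \<open>m\<close>, the estimator lies in \<open>T\<close> if the sample mean is close to \<open>m\<close>, and Chebyshev's
  inequality applies.
\<close>

lemma estimator_eventually_in_open:
  assumes "open T" "g m \<in> T"
  shows "(\<lambda>N. measure M {\<omega> \<in> space M. g (average N \<omega>) \<in> T}) \<longlonglongrightarrow> 1"
proof -
  have "continuous (at m) g"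
    using g_deriv has_derivative_continuous by blast
  moreover obtain e where "e > 0" and e: "ball (g m) e \<subseteq> T"
    using assms open_contains_ball by blast
  ultimately obtain d where d: "d > 0" "\<And>y. dist y m < d \<Longrightarrow> dist (g y) (g m) < e"
    unfolding continuous_at_eps_delta by (auto simp: dist_norm)
  then have d: "d > 0" "\<And>y. norm (y - m) < d \<Longrightarrow> g y \<in> T"
    using e by (auto simp: dist_norm[symmetric] dist_commute subset_iff)
  have lower: "1 - total_variance / d\<^sup>2 * (1 / real N) \<le> measure M {\<omega> \<in> space M. g (average N \<omega>) \<in> T}" if N: "N \<ge> 1" for N
  proof -
    let ?A = "{\<omega> \<in> space M. g (average N \<omega>) \<in> T}"
    have A: "?A \<in> sets M"
      using measurable_sets[OF g_average_measurable[of N], of T] assms(1) by (simp add: vimage_def Int_def conj_commute)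
    have "1 - 1 / (real N * d)\<^sup>2 * (norm (partial_sum N \<omega>))\<^sup>2 \<le> indicator ?A \<omega>" if "\<omega> \<in> space M" for \<omega>
    proof (cases "norm (partial_sum N \<omega>) < real N * d")
      case True
      then have "norm (average N \<omega> - m) < d" using N by (simp add: average_def field_simps)
      then show ?thesis using d(2) that by simp
    next
      case False
      have "1 \<le> 1 / (real N * d)\<^sup>2 * (norm (partial_sum N \<omega>))\<^sup>2"
        using False N d power_mono[of "real N * d" "norm (partial_sum N \<omega>)" 2] by (simp add: field_simps)
      then show ?thesis by (simp add: indicator_def)
    qed
    then have "(\<integral>\<omega>. 1 - 1 / (real N * d)\<^sup>2 * (norm (partial_sum N \<omega>))\<^sup>2 \<partial>M) \<le> (\<integral>\<omega>. indicator ?A \<omega> \<partial>M)"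
      using second_moment(1)[of N] A
      by (intro integral_mono Bochner_Integration.integrable_diff integrable_mult_right) (auto simp: emeasure_eq_measure)
    then have "1 - 1 / (real N * d)\<^sup>2 * (real N * total_variance) \<le> measure M ?A"
      using second_moment[of N] A by (simp add: prob_space)
    also have "1 / (real N * d)\<^sup>2 * (real N * total_variance) = total_variance / d\<^sup>2 * (1 / real N)"
      using N d by (simp add: power2_eq_square field_simps)
    finally show ?thesis .
  qed
  show ?thesis
  proof (rule tendsto_sandwich)
    have "(\<lambda>N. 1 - total_variance / d\<^sup>2 * (1 / real N)) \<longlonglongrightarrow> 1 - total_variance / d\<^sup>2 * 0"
      by (intro tendsto_diff tendsto_mult tendsto_const lim_1_over_n)
    then show "(\<lambda>N. 1 - total_variance / d\<^sup>2 * (1 / real N)) \<longlonglongrightarrow> 1" by simp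
    show "eventually (\<lambda>N. 1 - total_variance / d\<^sup>2 * (1 / real N) \<le> measure M {\<omega> \<in> space M. g (average N \<omega>) \<in> T}) sequentially"
      by (rule eventually_sequentiallyI[of 1]) (rule lower)
    show "eventually (\<lambda>N. measure M {\<omega> \<in> space M. g (average N \<omega>) \<in> T} \<le> 1) sequentially"
      by (rule always_eventually) simp
  qed (rule tendsto_const)
qed

end
end

text \<open>
  Centering \<open>h (X n)\<close> at its mean turns \<open>covariance_of P h \<theta>\<close> into a matrix of second moments, and the
  delta method applies. The estimator exists with probability tending to 1 because \<open>\<Theta>\<close> is a neighbourhood
  of \<open>\<theta>\<close>.
\<close>

theorem moment_estimator_asymptotic_covariance:
  fixes P :: "real^'d \<Rightarrow> 'b::topological_space measure" and h :: "'b \<Rightarrow> real^'m"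
    and g :: "real^'m \<Rightarrow> real^'d" and G :: "real^'m^'d"
  assumes M: "prob_space M" and sample: "random_sample M X (P \<theta>)"
    and h: "h \<in> borel_measurable borel" and sq: "integrable (P \<theta>) (\<lambda>x. (norm (h x))\<^sup>2)"
    and g: "g \<in> borel_measurable borel" and g_mean: "g (mean_of P h \<theta>) = \<theta>"
    and deriv: "(g has_derivative (\<lambda>u. G *v u)) (at (mean_of P h \<theta>))"
    and \<Theta>: "open \<Theta>" "\<theta> \<in> \<Theta>"
    and T: "\<And>N x. T N x = g (sample_mean N (\<lambda>n. h (x n)))"
  shows "has_asymptotic_covariance M \<Theta> \<theta> (\<lambda>N \<omega>. T N (\<lambda>n. X n \<omega>))
           (G ** covariance_of P h \<theta> ** transpose G)"
proof -
  interpret prob_space M by (rule M)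
  have X: "indep_vars (\<lambda>_. borel) X {1..}" "\<And>n. n \<ge> 1 \<Longrightarrow> distr M borel (X n) = P \<theta>"
    using sample by (auto simp: random_sample_def)
  have X_meas: "X n \<in> borel_measurable M" if "n \<ge> 1" for n
    using X(1) that by (auto simp: indep_vars_def2)
  have [measurable_cong]: "sets (P \<theta>) = sets borel" using X(2)[of 1] by (metis order_refl sets_distr)
  interpret P: prob_space "P \<theta>" using X(2)[of 1] X_meas[of 1] prob_space_distr by (metis order_refl)
  define m where "m = mean_of P h \<theta>"
  have "integrable (P \<theta>) (\<lambda>x. norm (h x))"
    by (rule P.square_integrable_imp_integrable[OF _ sq]) (use h in simp)
  then have h_int: "integrable (P \<theta>) h" using h by (simp add: integrable_norm_iff)
  define Q where "Q = distr (P \<theta>) borel (\<lambda>x. h x - m)"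
  have hm: "(\<lambda>x. h x - m) \<in> borel_measurable borel" using h by simp
  interpret centered_sample M "\<lambda>n \<omega>. h (X n \<omega>) - m" Q "covariance_of P h \<theta>"
  proof
    show "indep_vars (\<lambda>_. borel) (\<lambda>n \<omega>. h (X n \<omega>) - m) {1..}"
      using h by (intro indep_vars_compose2[OF X(1)]) auto
    show "distr M borel (\<lambda>\<omega>. h (X n \<omega>) - m) = Q" if "n \<ge> 1" for n
      unfolding Q_def X(2)[OF that, symmetric] using X_meas[OF that] hm
      by (subst distr_distr) (auto simp: comp_def)
    have "integrable (P \<theta>) (\<lambda>x. (norm (h x - m))\<^sup>2)"
    proof (rule Bochner_Integration.integrable_bound)
      show "integrable (P \<theta>) (\<lambda>x. 2 * (norm (h x))\<^sup>2 + 2 * (norm m)\<^sup>2)" using sq by simp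
      have "(norm (h x - m))\<^sup>2 \<le> 2 * (norm (h x))\<^sup>2 + 2 * (norm m)\<^sup>2" for x
      proof -
        have "(norm (h x - m))\<^sup>2 \<le> (norm (h x) + norm m)\<^sup>2"
          by (intro power_mono norm_triangle_ineq4) simp
        also have "\<dots> \<le> 2 * (norm (h x))\<^sup>2 + 2 * (norm m)\<^sup>2"
          using zero_le_power2[of "norm (h x) - norm m"] by (simp add: power2_sum power2_diff)
        finally show ?thesis .
      qed
      then show "AE x in P \<theta>. norm ((norm (h x - m))\<^sup>2) \<le> norm (2 * (norm (h x))\<^sup>2 + 2 * (norm m)\<^sup>2)"
        by (simp add: abs_of_nonneg)
    qed (use h in simp)
    then show "integrable Q (\<lambda>x. (norm x)\<^sup>2)"
      unfolding Q_def using hm by (subst integrable_distr_eq) auto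
    show "(\<integral>x. x \<partial>Q) = 0"
      unfolding Q_def using hm h_int by (subst integral_distr) (auto simp: P.prob_space m_def mean_of_def)
    show "covariance_of P h \<theta> = (\<chi> i j. \<integral>x. x $ i * x $ j \<partial>Q)"
      unfolding Q_def covariance_of_def using hm by (subst integral_distr) (auto simp: m_def)
  qed
  note deriv' = deriv[folded m_def]
  have estimator_eq: "T N (\<lambda>n. X n \<omega>) = g (average m N \<omega>)" if "N \<ge> 1" for N \<omega>
  proof -
    have "sample_mean N (\<lambda>n. h (X n \<omega>)) = average m N \<omega>"
      using that by (simp add: sample_mean_def average_def[OF g deriv'] partial_sum_def sum_subtractf scaleR_diff_right sum_constant_scaleR del: sum_constant)
    then show ?thesis by (simp add: T)
  qed
  have "(\<lambda>\<omega>. T N (\<lambda>n. X n \<omega>)) \<in> borel_measurable M" for N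
  proof -
    have "(\<lambda>\<omega>. sample_mean N (\<lambda>n. h (X n \<omega>))) \<in> borel_measurable M"
      unfolding sample_mean_def
      using measurable_compose[OF X_meas h] by (intro borel_measurable_scaleR borel_measurable_sum) auto
    then show ?thesis unfolding T by (rule measurable_compose[OF _ g])
  qed
  moreover have "(\<lambda>N. measure M {\<omega> \<in> space M. T N (\<lambda>n. X n \<omega>) \<in> \<Theta>}) \<longlonglongrightarrow> 1"
    by (rule Lim_transform_eventually[OF estimator_eventually_in_open[OF g deriv' \<Theta>(1)]])
       (use g_mean \<Theta> estimator_eq in \<open>auto simp: m_def intro!: eventually_sequentiallyI[of 1]\<close>)
  moreover have "\<exists>\<mu>. centered_normal (G ** covariance_of P h \<theta> ** transpose G) \<mu> \<and>
     weakly_converges (\<lambda>N. distr M borel (\<lambda>\<omega>. sqrt (real N) *\<^sub>R (T N (\<lambda>n. X n \<omega>) - \<theta>))) \<mu>"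
  proof -
    have "(\<lambda>\<omega>. sqrt (real N) *\<^sub>R (T N (\<lambda>n. X n \<omega>) - \<theta>)) = scaled_error m g N" for N
      using estimator_eq[of N] g_mean[folded m_def] by (cases "N = 0") (auto simp: scaled_error_def[OF g deriv'] fun_eq_iff)
    then show ?thesis using delta_method[OF g deriv'] by simp
  qed
  ultimately show ?thesis unfolding has_asymptotic_covariance_def by blast
qed

section \<open>Increments of a multivariate gamma vector\<close>

lemma vec_nth_measurable [measurable]: "(\<lambda>x :: real^'n. x $ i) \<in> borel_measurable borel"
  by (intro borel_measurable_continuous_onI continuous_intros)

lemma Max_below:
  fixes i :: "'k::{finite,wellorder}"
  assumes "{..<i} \<noteq> {}"
  shows "Max {..<i} < i" "{..<i} = {..Max {..<i}}"
proof -
  show "Max {..<i} < i" using Max_in[of "{..<i}"] assms by simp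
  then show "{..<i} = {..Max {..<i}}" by (auto intro: le_less_trans)
qed

lemma sum_increments:
  fixes x :: "real^'k::{finite,wellorder}"
  shows "(\<Sum>j\<le>i. increments x $ j) = x $ i"
proof (induction i rule: less_induct)
  case (less i)
  have split: "{..i} = insert i {..<i}" by auto
  show ?case
  proof (cases "{..<i} = {}")
    case True
    then show ?thesis unfolding split by (simp add: increments_def)
  next
    case False
    have "(\<Sum>j\<in>{..<i}. increments x $ j) = x $ Max {..<i}"
      using less.IH[OF Max_below(1)[OF False]] Max_below(2)[OF False] by simp
    then show ?thesis using False unfolding split by (simp add: increments_def)
  qed
qed

lemma increments_pos_iff:
  fixes x :: "real^'k::{finite,wellorder}"
  shows "(\<forall>i. 0 < x $ i) \<and> (\<forall>i j. i < j \<longrightarrow> x $ i < x $ j) \<longleftrightarrow> (\<forall>i. 0 < increments x $ i)"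
proof (intro iffI conjI allI impI)
  fix i assume "(\<forall>i. 0 < x $ i) \<and> (\<forall>i j. i < j \<longrightarrow> x $ i < x $ j)"
  then show "0 < increments x $ i" using Max_below(1)[of i] by (simp add: increments_def)
next
  assume pos: "\<forall>i. 0 < increments x $ i"
  show "0 < x $ i" for i
    unfolding sum_increments[of x i, symmetric] using pos by (intro sum_pos) auto
  show "x $ i < x $ j" if "i < j" for i j
    unfolding sum_increments[of x i, symmetric] sum_increments[of x j, symmetric]
    using pos that by (intro sum_strict_mono2[where b=j]) (auto simp: less_imp_le)
qed

lemma linear_increments: "linear (increments :: real^'k::{finite,wellorder} \<Rightarrow> real^'k::_)"
  by (rule linearI) (auto simp: increments_def vec_eq_iff algebra_simps)

lemma increments_measurable [measurable]: "increments \<in> borel_measurable borel"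
  using linear_continuous_on[of increments UNIV] linear_increments
  by (intro borel_measurable_continuous_onI) (simp add: linear_linear)

lemma inj_increments: "inj (increments :: real^'k::{finite,wellorder} \<Rightarrow> real^'k::_)"
  by (rule injI) (metis sum_increments vec_eq_iff)

lemma det_increments: "det (matrix (increments :: real^'k::{finite,wellorder} \<Rightarrow> real^'k::_)) = 1"
proof -
  have lower: "matrix (increments :: real^'k::_ \<Rightarrow> real^'k::_) $ i $ j = 0" if "i < j" for i j :: 'k
  proof (cases "{..<i} = {}")
    case True
    then show ?thesis using that by (simp add: matrix_def increments_def axis_def)
  next
    case False
    then have "Max {..<i} \<noteq> j" "i \<noteq> j" using that Max_below(1)[OF False] by (metis less_asym less_irrefl)+
    then show ?thesis using False by (simp add: matrix_def increments_def axis_def)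
  qed
  have "matrix (increments :: real^'k::_ \<Rightarrow> real^'k::_) $ i $ i = 1" for i :: 'k
  proof (cases "{..<i} = {}")
    case True
    then show ?thesis by (simp add: matrix_def increments_def axis_def)
  next
    case False
    then have "Max {..<i} \<noteq> i" using Max_below(1)[OF False] by (metis less_irrefl)
    then show ?thesis using False by (simp add: matrix_def increments_def axis_def)
  qed
  then show ?thesis by (subst det_lowerdiagonal) (auto simp: lower)
qed

text \<open>
  The increments are a linear map with a unitriangular matrix, so they preserve volume.
\<close>

lemma lborel_increments: "distr lborel borel (increments :: real^'k::{finite,wellorder} \<Rightarrow> real^'k::_) = lborel"
proof (rule sym, rule lborel_eqI)
  fix l u :: "real^'k::_" assume le: "\<And>b. b \<in> Basis \<Longrightarrow> l \<bullet> b \<le> u \<bullet> b"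
  obtain g :: "real^'k::_ \<Rightarrow> real^'k::_" where g: "linear g" "\<And>x. g (increments x) = x" "\<And>x. increments (g x) = x"
    using linear_injective_isomorphism[OF linear_increments inj_increments] by blast
  let ?B = "box l u" and ?A = "g ` box l u"
  have A: "?A = increments -` ?B" by (auto simp: g(3)) (metis g(2) image_eqI)
  have B: "increments ` ?A = ?B" using g(3) by (simp add: image_image)
  have A_meas: "?A \<in> lmeasurable" by (intro measurable_linear_image g(1)) simp
  have A_borel: "?A \<in> sets borel" unfolding A using measurable_sets[OF increments_measurable, of ?B] by simp
  have "emeasure (distr lborel borel increments) ?B = emeasure lborel ?A"
    unfolding A by (subst emeasure_distr) auto
  also have "\<dots> = emeasure lebesgue ?A" using A_borel by simp
  also have "\<dots> = ennreal (measure lebesgue ?A)"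
    using A_meas by (simp add: emeasure_eq_measure2 fmeasurableD2)
  also have "measure lebesgue ?A = measure lebesgue ?B"
    using measure_linear_image[OF linear_increments A_meas] unfolding B det_increments by simp
  also have "ennreal (measure lebesgue ?B) = (\<Prod>b\<in>Basis. (u - l) \<bullet> b)"
    using le by (simp add: measure_lborel_box_eq)
  finally show "emeasure (distr lborel borel increments) ?B = (\<Prod>b\<in>Basis. (u - l) \<bullet> b)" .
qed simp

text \<open>
  The density of the gamma distribution with shape \<open>a\<close> and scale \<open>b\<close>.
\<close>

definition gamma_density :: "real \<Rightarrow> real \<Rightarrow> real \<Rightarrow> real" where
  "gamma_density a b z = (if 0 < z then exp (- z / b) * z powr (a - 1) / (b powr a * Gamma a) else 0)"

lemma gamma_density_measurable [measurable]: "gamma_density a b \<in> borel_measurable borel"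
  unfolding gamma_density_def[abs_def] by measurable

lemma gamma_density_nonneg: "0 < a \<Longrightarrow> 0 \<le> gamma_density a b z"
  using Gamma_real_pos[of a] by (simp add: gamma_density_def)

text \<open>
  Substituting \<open>t = z / b\<close> turns the integrand into that of the Euler integral for \<open>Gamma (a + n)\<close>. The
  absolute value makes the integrand nonnegative on the whole line.
\<close>

lemma gamma_density_moment:
  assumes a: "0 < a" and b: "0 < b"
  shows "(\<integral>\<^sup>+z. ennreal (gamma_density a b z * \<bar>z\<bar> ^ n) \<partial>lborel) = ennreal (b ^ n * Gamma (a + n) / Gamma a)"
proof -
  define s where "s = a + n"
  define f where "f t = indicator {0..} t * t powr (s - 1) / exp t" for t :: real
  have f_meas [measurable]: "f \<in> borel_measurable borel" unfolding f_def by measurable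
  have f_nn: "0 \<le> f t" for t by (simp add: f_def indicator_def)
  have pos: "0 < s" "0 < Gamma a" "0 < b powr a" using a b by (simp_all add: s_def add_pos_nonneg Gamma_real_pos)
  define c where "c = b ^ n / (b * Gamma a)"
  have c: "0 \<le> c" using b pos by (simp add: c_def)
  have dens: "gamma_density a b z * \<bar>z\<bar> ^ n = c * f (0 + (1 / b) * z)" for z
  proof (cases "0 < z")
    case True
    have "z powr (a - 1) * z ^ n = z powr (s - 1)"
      using True by (simp add: s_def powr_realpow[symmetric] powr_add[symmetric] algebra_simps)
    moreover have "b powr (s - 1) * b = b powr a * b ^ n"
      using b by (simp add: s_def powr_realpow[symmetric] powr_add[symmetric] powr_diff)
    ultimately show ?thesis
      using True b pos
      by (simp add: gamma_density_def f_def c_def powr_divide exp_minus field_simps)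
  next
    case False
    then have "z = 0 \<or> z / b < 0" using b by (auto simp: divide_less_0_iff)
    then show ?thesis using False by (auto simp: gamma_density_def f_def)
  qed
  have "ennreal (Gamma s) = (\<integral>\<^sup>+z. ennreal (f z) \<partial>lborel)"
    unfolding f_def by (rule Gamma_conv_nn_integral_real[OF pos(1)])
  also have "\<dots> = ennreal (1 / b) * (\<integral>\<^sup>+z. ennreal (f (0 + (1 / b) * z)) \<partial>lborel)"
    using b by (subst nn_integral_real_affine[where c="1/b" and t=0]) auto
  finally have G: "ennreal (Gamma s) = ennreal (1 / b) * (\<integral>\<^sup>+z. ennreal (f (0 + (1 / b) * z)) \<partial>lborel)" .
  have "(\<integral>\<^sup>+z. ennreal (gamma_density a b z * \<bar>z\<bar> ^ n) \<partial>lborel)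
      = ennreal c * (\<integral>\<^sup>+z. ennreal (f (0 + (1 / b) * z)) \<partial>lborel)"
    unfolding dens ennreal_mult'[OF c] by (rule nn_integral_cmult) measurable
  also have "ennreal c = ennreal (b ^ n / Gamma a) * ennreal (1 / b)"
    unfolding c_def using b pos by (subst ennreal_mult[symmetric]) auto
  also have "\<dots> * (\<integral>\<^sup>+z. ennreal (f (0 + (1 / b) * z)) \<partial>lborel) = ennreal (b ^ n / Gamma a) * ennreal (Gamma s)"
    unfolding G by (simp add: mult.assoc)
  also have "\<dots> = ennreal (b ^ n * Gamma (a + n) / Gamma a)"
    using b pos by (subst ennreal_mult[symmetric]) (auto simp: s_def Gamma_real_pos less_imp_le)
  finally show ?thesis .
qed

text \<open>
  In terms of the increments the density factorizes, because the last coordinate is the sum of all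
  increments and the support is the set where they are positive. So the increments of a multivariate gamma
  vector are independent and gamma distributed.
\<close>

lemma mgamma_density_eq_prod:
  fixes \<alpha> :: "real^'k::{finite,wellorder}"
  assumes b: "0 < \<beta>"
  shows "mgamma_density \<alpha> \<beta> x = (\<Prod>i\<in>UNIV. gamma_density (\<alpha> $ i) \<beta> (increments x $ i))"
proof (cases "\<forall>i. 0 < increments x $ i")
  case True
  have "{..Max UNIV} = (UNIV :: 'k set)" by (auto intro: Max_ge)
  then have "x $ Max UNIV = (\<Sum>i\<in>UNIV. increments x $ i)"
    using sum_increments[of x "Max UNIV"] by simp
  then have "exp (- (x $ Max UNIV) / \<beta>) = (\<Prod>i\<in>UNIV. exp (- (increments x $ i) / \<beta>))"
    by (simp add: exp_sum[symmetric] sum_negf sum_divide_distrib)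
  moreover have "\<beta> powr (\<Sum>i\<in>UNIV. \<alpha> $ i) = (\<Prod>i\<in>UNIV. \<beta> powr (\<alpha> $ i))"
    using b by (simp add: powr_sum)
  ultimately show ?thesis
    using True unfolding mgamma_density_def increments_pos_iff
    by (simp add: gamma_density_def prod.distrib prod_dividef)
next
  case False
  then show ?thesis unfolding mgamma_density_def increments_pos_iff
    by (auto simp: gamma_density_def intro!: prod_zero[symmetric])
qed

lemma nn_integral_lborel_prod_vec:
  fixes f :: "'k::finite \<Rightarrow> real \<Rightarrow> ennreal"
  assumes [measurable]: "\<And>i. f i \<in> borel_measurable borel"
  shows "(\<integral>\<^sup>+x. (\<Prod>i\<in>UNIV. f i (x $ i)) \<partial>(lborel :: (real^'k) measure)) = (\<Prod>i\<in>UNIV. \<integral>\<^sup>+s. f i s \<partial>lborel)"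
proof -
  have basis: "(\<Prod>b\<in>(Basis :: (real^'k) set). F b) = (\<Prod>i\<in>UNIV. F (axis i 1))" for F :: "real^'k \<Rightarrow> ennreal"
  proof -
    have "(Basis :: (real^'k) set) = range (\<lambda>i. axis i 1)" by (auto simp: Basis_vec_def)
    moreover have "inj (\<lambda>i::'k. axis i (1::real))" by (auto simp: inj_def axis_eq_axis)
    ultimately show ?thesis by (metis (no_types, lifting) prod.reindex_cong)
  qed
  have "(\<integral>\<^sup>+x. (\<Prod>b\<in>Basis. f (axis_index b) (x \<bullet> b)) \<partial>(lborel :: (real^'k) measure))
      = (\<Prod>b\<in>(Basis :: (real^'k) set). \<integral>\<^sup>+s. f (axis_index b) s \<partial>lborel)"
    by (rule nn_integral_lborel_prod) auto
  then show ?thesis by (simp add: basis inner_axis)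
qed

lemma mgamma_density_measurable [measurable]:
  assumes "0 < \<beta>"
  shows "mgamma_density \<alpha> \<beta> \<in> borel_measurable borel"
proof -
  have "(\<lambda>x. \<Prod>i\<in>UNIV. gamma_density (\<alpha> $ i) \<beta> (increments x $ i)) \<in> borel_measurable borel"
    by measurable
  also have "(\<lambda>x. \<Prod>i\<in>UNIV. gamma_density (\<alpha> $ i) \<beta> (increments x $ i)) = mgamma_density \<alpha> \<beta>"
    using mgamma_density_eq_prod[OF assms] by (intro ext) (rule sym)
  finally show ?thesis .
qed

text \<open>
  After the volume preserving change of variables to the increments, all factors except the \<open>j\<close>-th integrate
  to 1.
\<close>

lemma nn_integral_mgamma_increment:
  fixes \<alpha> :: "real^'k::{finite,wellorder}"
  assumes a: "\<forall>i. 0 < \<alpha> $ i" and b: "0 < \<beta>"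
    and f: "f \<in> borel_measurable borel" "\<And>z. 0 \<le> f z"
  shows "(\<integral>\<^sup>+x. ennreal (f (increments x $ j)) \<partial>mgamma \<alpha> \<beta>)
       = (\<integral>\<^sup>+z. ennreal (gamma_density (\<alpha> $ j) \<beta> z * f z) \<partial>lborel)"
proof -
  note [measurable] = f(1)
  let ?g = "\<lambda>i z. ennreal (gamma_density (\<alpha> $ i) \<beta> z * (if i = j then f z else 1))"
  have nn: "0 \<le> gamma_density (\<alpha> $ i) \<beta> z" for i z using a gamma_density_nonneg by blast
  have "(\<integral>\<^sup>+x. ennreal (f (increments x $ j)) \<partial>mgamma \<alpha> \<beta>)
      = (\<integral>\<^sup>+x. ennreal (mgamma_density \<alpha> \<beta> x) * ennreal (f (increments x $ j)) \<partial>lborel)"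
    unfolding mgamma_def using mgamma_density_measurable[OF b, of \<alpha>]
    by (subst nn_integral_density) auto
  also have "\<dots> = (\<integral>\<^sup>+x. (\<Prod>i\<in>UNIV. ?g i (increments x $ i)) \<partial>lborel)"
  proof (rule nn_integral_cong)
    fix x :: "real^'k::_"
    have "mgamma_density \<alpha> \<beta> x * f (increments x $ j)
        = (\<Prod>i\<in>UNIV. gamma_density (\<alpha> $ i) \<beta> (increments x $ i) * (if i = j then f (increments x $ i) else 1))"
      by (simp add: mgamma_density_eq_prod[OF b] prod.distrib)
    then show "ennreal (mgamma_density \<alpha> \<beta> x) * ennreal (f (increments x $ j)) = (\<Prod>i\<in>UNIV. ?g i (increments x $ i))"
      using nn f(2) by (subst prod_ennreal) (auto simp: ennreal_mult''[OF f(2), symmetric])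
  qed
  also have "\<dots> = (\<integral>\<^sup>+y. (\<Prod>i\<in>UNIV. ?g i (y $ i)) \<partial>distr lborel borel increments)"
    by (subst nn_integral_distr) auto
  also have "\<dots> = (\<Prod>i\<in>UNIV. \<integral>\<^sup>+z. ?g i z \<partial>lborel)"
    unfolding lborel_increments by (rule nn_integral_lborel_prod_vec) auto
  also have "\<dots> = (\<Prod>i\<in>UNIV. if i = j then (\<integral>\<^sup>+z. ennreal (gamma_density (\<alpha> $ j) \<beta> z * f z) \<partial>lborel) else 1)"
  proof (rule prod.cong[OF refl])
    fix i
    have "(\<integral>\<^sup>+z. ennreal (gamma_density (\<alpha> $ i) \<beta> z) \<partial>lborel) = 1"
      using gamma_density_moment[of "\<alpha> $ i" \<beta> 0] a b less_imp_neq[OF Gamma_real_pos[of "\<alpha> $ i"]] by simp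
    then show "(\<integral>\<^sup>+z. ?g i z \<partial>lborel) = (if i = j then (\<integral>\<^sup>+z. ennreal (gamma_density (\<alpha> $ j) \<beta> z * f z) \<partial>lborel) else 1)"
      by simp
  qed
  finally show ?thesis by simp
qed

lemma sets_mgamma [simp, measurable_cong]: "sets (mgamma \<alpha> \<beta>) = sets borel"
  by (simp add: mgamma_def)

lemma AE_mgamma_increments_pos:
  assumes b: "0 < \<beta>"
  shows "AE x in mgamma \<alpha> \<beta>. 0 < increments x $ i"
proof -
  have "0 < increments x $ i" if "0 < ennreal (mgamma_density \<alpha> \<beta> x)" for x
  proof (rule ccontr)
    assume "\<not> 0 < increments x $ i"
    then have "mgamma_density \<alpha> \<beta> x = 0" unfolding mgamma_density_def increments_pos_iff by auto
    with that show False by simp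
  qed
  then show ?thesis
    unfolding mgamma_def using mgamma_density_measurable[OF b, of \<alpha>] by (subst AE_density) auto
qed

lemma mgamma_increment_moment:
  fixes \<alpha> :: "real^'k::{finite,wellorder}"
  assumes a: "\<forall>i. 0 < \<alpha> $ i" and b: "0 < \<beta>"
  shows "integrable (mgamma \<alpha> \<beta>) (\<lambda>x. (increments x $ j) ^ n)"
    and "(\<integral>x. (increments x $ j) ^ n \<partial>mgamma \<alpha> \<beta>) = \<beta> ^ n * Gamma (\<alpha> $ j + n) / Gamma (\<alpha> $ j)"
proof -
  have nn: "0 \<le> \<beta> ^ n * Gamma (\<alpha> $ j + n) / Gamma (\<alpha> $ j)"
    using a b by (simp add: Gamma_real_pos less_imp_le add_pos_nonneg)
  have ae: "AE x in mgamma \<alpha> \<beta>. 0 < increments x $ j" by (rule AE_mgamma_increments_pos[OF b])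
  have "(\<integral>\<^sup>+x. ennreal ((increments x $ j) ^ n) \<partial>mgamma \<alpha> \<beta>) = (\<integral>\<^sup>+x. ennreal (\<bar>increments x $ j\<bar> ^ n) \<partial>mgamma \<alpha> \<beta>)"
    by (intro nn_integral_cong_AE) (use ae in eventually_elim, simp)
  also have "\<dots> = ennreal (\<beta> ^ n * Gamma (\<alpha> $ j + n) / Gamma (\<alpha> $ j))"
    using nn_integral_mgamma_increment[OF a b, of "\<lambda>z. \<bar>z\<bar> ^ n" j] gamma_density_moment[of "\<alpha> $ j" \<beta> n] a b by simp
  finally have "(\<integral>\<^sup>+x. ennreal ((increments x $ j) ^ n) \<partial>mgamma \<alpha> \<beta>) = ennreal (\<beta> ^ n * Gamma (\<alpha> $ j + n) / Gamma (\<alpha> $ j))" .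
  moreover have "AE x in mgamma \<alpha> \<beta>. 0 \<le> (increments x $ j) ^ n"
    using ae by eventually_elim simp
  ultimately have "integrable (mgamma \<alpha> \<beta>) (\<lambda>x. (increments x $ j) ^ n) \<and>
    (\<integral>x. (increments x $ j) ^ n \<partial>mgamma \<alpha> \<beta>) = \<beta> ^ n * Gamma (\<alpha> $ j + n) / Gamma (\<alpha> $ j)"
    using nn by (subst (asm) nn_integral_eq_integrable) auto
  then show "integrable (mgamma \<alpha> \<beta>) (\<lambda>x. (increments x $ j) ^ n)"
    "(\<integral>x. (increments x $ j) ^ n \<partial>mgamma \<alpha> \<beta>) = \<beta> ^ n * Gamma (\<alpha> $ j + n) / Gamma (\<alpha> $ j)" by auto
qed

lemma mgamma_increment_mean:
  fixes \<alpha> :: "real^'k::{finite,wellorder}"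
  assumes a: "\<forall>i. 0 < \<alpha> $ i" and b: "0 < \<beta>"
  shows "(\<integral>x. increments x $ j \<partial>mgamma \<alpha> \<beta>) = \<alpha> $ j * \<beta>"
    and "(\<integral>x. (increments x $ j)\<^sup>2 \<partial>mgamma \<alpha> \<beta>) = \<alpha> $ j * (\<alpha> $ j + 1) * \<beta>\<^sup>2"
proof -
  have aj: "0 < \<alpha> $ j" using a by simp
  then have G: "Gamma (\<alpha> $ j) > 0" by (rule Gamma_real_pos)
  have np: "x \<notin> \<int>\<^sub>\<le>\<^sub>0" if "0 < x" for x :: real
    using that by (auto elim!: nonpos_Ints_cases)
  have G1: "Gamma (\<alpha> $ j + 1) = \<alpha> $ j * Gamma (\<alpha> $ j)"
    using np[OF aj] by (rule Gamma_plus1)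
  have G2: "Gamma (\<alpha> $ j + 2) = (\<alpha> $ j + 1) * Gamma (\<alpha> $ j + 1)"
    using aj Gamma_plus1[OF np, of "\<alpha> $ j + 1"] by (simp add: add.assoc)
  show "(\<integral>x. increments x $ j \<partial>mgamma \<alpha> \<beta>) = \<alpha> $ j * \<beta>"
    using mgamma_increment_moment(2)[OF a b, of j 1] G by (simp add: G1)
  show "(\<integral>x. (increments x $ j)\<^sup>2 \<partial>mgamma \<alpha> \<beta>) = \<alpha> $ j * (\<alpha> $ j + 1) * \<beta>\<^sup>2"
    using mgamma_increment_moment(2)[OF a b, of j 2] G by (simp add: G1 G2)
qed

section \<open>Moments and linearization of the Moment Estimator\<close>

lemma integrable_vecI:
  fixes f :: "'a \<Rightarrow> real^'n"
  assumes "\<And>i. integrable M (\<lambda>x. f x $ i)"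
  shows "integrable M f"
proof -
  have "f = (\<lambda>x. \<Sum>i\<in>UNIV. f x $ i *\<^sub>R axis i 1)"
    by (simp add: fun_eq_iff vec_eq_iff axis_def if_distrib cong: if_cong)
  moreover have "integrable M (\<lambda>x. \<Sum>i\<in>UNIV. f x $ i *\<^sub>R axis i (1::real))"
    using assms by (intro Bochner_Integration.integrable_sum integrable_scaleR_left) auto
  ultimately show ?thesis by metis
qed

lemma sum_UNIV_sum_type:
  fixes f :: "'a::finite + 'b::finite \<Rightarrow> 'c::comm_monoid_add"
  shows "(\<Sum>c\<in>UNIV. f c) = (\<Sum>i\<in>UNIV. f (Inl i)) + (\<Sum>j\<in>UNIV. f (Inr j))"
  using sum.Plus[of UNIV UNIV f] by simp

lemma moment_h_measurable: "(moment_h :: real^'k::{finite,wellorder} \<Rightarrow> _) \<in> borel_measurable borel"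
proof (rule borel_measurable_euclidean_space[THEN iffD2], rule ballI)
  fix b :: "real^('k + 'k)" assume "b \<in> Basis"
  then obtain c where b: "b = axis c 1" by (auto simp: Basis_vec_def)
  show "(\<lambda>x. moment_h x \<bullet> b) \<in> borel_measurable borel"
    by (cases c) (simp_all add: b inner_axis moment_h_def)
qed

lemma moment_g_measurable: "(moment_g :: real^('k::finite + 'k) \<Rightarrow> _) \<in> borel_measurable borel"
proof (rule borel_measurable_euclidean_space[THEN iffD2], rule ballI)
  fix b :: "real^('k + 1)" assume "b \<in> Basis"
  then obtain c where b: "b = axis c 1" by (auto simp: Basis_vec_def)
  have "(moment_g_scale :: real^('k + 'k) \<Rightarrow> _) \<in> borel_measurable borel"
    unfolding moment_g_scale_def[abs_def] by measurable
  then show "(\<lambda>y. moment_g y \<bullet> b) \<in> borel_measurable borel"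
    by (cases c) (simp_all add: b inner_axis moment_g_def)
qed

lemma moment_estimator_eq_g: "moment_estimator N x = moment_g (sample_mean N (\<lambda>n. moment_h (x n)))"
proof -
  have "sample_mean N (\<lambda>n. moment_h (x n)) $ Inl j = sample_mean N (\<lambda>n. increments (x n) $ j)"
    "sample_mean N (\<lambda>n. moment_h (x n)) $ Inr j = sample_mean N (\<lambda>n. (increments (x n) $ j)\<^sup>2)" for j
    by (simp_all add: sample_mean_def moment_h_def)
  then show ?thesis
    by (simp add: moment_estimator_def mgamma_param_def moment_g_def moment_g_scale_def Let_def vec_eq_iff
        split: sum.split)
qed

text \<open>
  The first and second moments of independent gamma variables with shapes \<open>\<alpha>\<^sub>j\<close> and scale \<open>\<beta>\<close>, that is, the
  value of \<open>e\<^sub>h(\<alpha>, \<beta>)\<close>.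
\<close>

definition gamma_moments :: "real^('k::finite + 1) \<Rightarrow> real^('k + 'k)" where
  "gamma_moments \<theta> = (\<chi> c. case c of Inl j \<Rightarrow> \<theta> $ Inl j * \<theta> $ Inr 1
                                  | Inr j \<Rightarrow> \<theta> $ Inl j * (\<theta> $ Inl j + 1) * (\<theta> $ Inr 1)\<^sup>2)"

lemma gamma_moments_nth [simp]:
  "gamma_moments \<theta> $ Inl j = \<theta> $ Inl j * \<theta> $ Inr 1"
  "gamma_moments \<theta> $ Inr j = \<theta> $ Inl j * (\<theta> $ Inl j + 1) * (\<theta> $ Inr 1)\<^sup>2"
  by (simp_all add: gamma_moments_def)

text \<open>
  Square integrability of \<open>moment_h\<close>, which the central limit theorem requires, amounts to the existence of
  the fourth moments of the increments.
\<close>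

lemma mgamma_family_moments:
  fixes \<theta> :: "real^('k::{finite,wellorder} + 1)"
  assumes "\<theta> \<in> mgamma_params"
  shows "integrable (mgamma_family \<theta>) moment_h"
    and "integrable (mgamma_family \<theta>) (\<lambda>x. (norm (moment_h x))\<^sup>2)"
    and "mean_of mgamma_family moment_h \<theta> = gamma_moments \<theta>"
proof -
  have a: "\<forall>i. 0 < (\<chi> i. \<theta> $ Inl i) $ i" and b: "0 < \<theta> $ Inr 1"
    using assms by (simp_all add: mgamma_params_def)
  note moments = mgamma_increment_moment(1)[OF a b, folded mgamma_family_def]
    and means = mgamma_increment_mean[OF a b, folded mgamma_family_def]
  have comp: "integrable (mgamma_family \<theta>) (\<lambda>x. moment_h x $ c)" for c
    using moments[of _ 1] moments[of _ 2] by (cases c) (simp_all add: moment_h_def)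
  then show int: "integrable (mgamma_family \<theta>) moment_h" by (rule integrable_vecI)
  have "integrable (mgamma_family \<theta>) (\<lambda>x. (moment_h x $ c)\<^sup>2)" for c
    using moments[of _ 2] moments[of _ 4] by (cases c) (simp_all add: moment_h_def)
  then have "integrable (mgamma_family \<theta>) (\<lambda>x. \<Sum>c\<in>UNIV. (moment_h x $ c)\<^sup>2)"
    by (intro Bochner_Integration.integrable_sum)
  then show "integrable (mgamma_family \<theta>) (\<lambda>x. (norm (moment_h x))\<^sup>2)"
    unfolding power2_norm_eq_inner inner_vec_def by (simp add: power2_eq_square)
  have "mean_of mgamma_family moment_h \<theta> $ c = (\<integral>x. moment_h x $ c \<partial>mgamma_family \<theta>)" for c
    unfolding mean_of_def using integral_bounded_linear[OF bounded_linear_vec_nth int] by simp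
  then show "mean_of mgamma_family moment_h \<theta> = gamma_moments \<theta>"
    using means by (simp add: vec_eq_iff gamma_moments_def moment_h_def split: sum.split)
qed

text \<open>
  For a gamma variable the quotient of variance and mean is \<open>\<alpha>\<^sub>j \<beta>\<^sup>2 / (\<alpha>\<^sub>j \<beta>) = \<beta>\<close>, so every term of the
  average is equal to \<open>\<beta>\<close>.
\<close>

lemma moment_g_scale_gamma_moments:
  assumes "\<theta> \<in> mgamma_params"
  shows "moment_g_scale (gamma_moments \<theta>) = \<theta> $ Inr 1"
proof -
  have "(gamma_moments \<theta> $ Inr j - (gamma_moments \<theta> $ Inl j)\<^sup>2) / gamma_moments \<theta> $ Inl j = \<theta> $ Inr 1" for j
  proof -
    have "\<theta> $ Inl j > 0" "\<theta> $ Inr 1 > 0" using assms by (simp_all add: mgamma_params_def)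
    then show ?thesis by (simp add: power2_eq_square field_simps)
  qed
  then show ?thesis by (simp add: moment_g_scale_def)
qed

lemma moment_g_gamma_moments:
  assumes "\<theta> \<in> mgamma_params"
  shows "moment_g (gamma_moments \<theta>) = \<theta>"
proof -
  have "\<theta> $ Inr 1 > 0" using assms by (simp add: mgamma_params_def)
  then have "\<theta> $ Inr 1 \<noteq> 0" by simp
  moreover have "(x :: 1) = 1" for x by (rule num1_eq1)
  ultimately show ?thesis
    by (auto simp: moment_g_def moment_g_scale_gamma_moments[OF assms] vec_eq_iff split: sum.split)
qed

text \<open>
  The \<open>j\<close>-th term of the average has the partial derivatives \<open>1 / y\<^sub>j = 1 / (\<alpha>\<^sub>j \<beta>)\<close> with respect to \<open>y\<^sub>k\<^sub>+\<^sub>j\<close> and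
  \<open>- y\<^sub>k\<^sub>+\<^sub>j / y\<^sub>j\<^sup>2 - 1 = - (2 + 1 / \<alpha>\<^sub>j)\<close> with respect to \<open>y\<^sub>j\<close>, which, divided by \<open>k\<close>, is the last row of
  \<open>moment_G\<close>.
\<close>

lemma moment_g_scale_has_derivative:
  fixes \<alpha> :: "real^'k::finite"
  assumes "\<forall>i. 0 < \<alpha> $ i" "0 < \<beta>"
  shows "(moment_g_scale has_derivative (\<lambda>u. (moment_G \<alpha> \<beta> *v u) $ Inr 1)) (at (gamma_moments (mgamma_param \<alpha> \<beta>)))"
proof -
  define y where "y = gamma_moments (mgamma_param \<alpha> \<beta>)"
  have y: "y $ Inl j = \<alpha> $ j * \<beta>" "y $ Inr j = \<alpha> $ j * (\<alpha> $ j + 1) * \<beta>\<^sup>2" for j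
    by (simp_all add: y_def mgamma_param_def)
  have nz: "\<alpha> $ j \<noteq> 0" "\<beta> \<noteq> 0" for j using assms by (simp_all add: less_imp_neq[symmetric])
  have nth: "((\<lambda>y. y $ c) has_derivative (\<lambda>u. u $ c)) (at y)" for c
    by (rule bounded_linear_imp_has_derivative[OF bounded_linear_vec_nth])
  have summand: "((\<lambda>y. (y $ Inr j - (y $ Inl j)\<^sup>2) / y $ Inl j) has_derivative
      (\<lambda>u. u $ Inr j / (\<alpha> $ j * \<beta>) - (2 + 1 / \<alpha> $ j) * u $ Inl j)) (at y)" for j
    using nz y[of j]
    by (auto intro!: derivative_eq_intros nth simp: fun_eq_iff power2_eq_square field_simps)
  have "(moment_g_scale has_derivative
      (\<lambda>u. 1 / real CARD('k) * (\<Sum>j\<in>UNIV. u $ Inr j / (\<alpha> $ j * \<beta>) - (2 + 1 / \<alpha> $ j) * u $ Inl j))) (at y)"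
    unfolding moment_g_scale_def[abs_def] by (intro has_derivative_mult_right has_derivative_sum summand)
  also have "(\<lambda>u. 1 / real CARD('k) * (\<Sum>j\<in>UNIV. u $ Inr j / (\<alpha> $ j * \<beta>) - (2 + 1 / \<alpha> $ j) * u $ Inl j))
      = (\<lambda>u. (moment_G \<alpha> \<beta> *v u) $ Inr 1)"
    by (simp add: fun_eq_iff matrix_vector_mult_def sum_UNIV_sum_type moment_G_def Let_def
        sum_subtractf sum_distrib_left right_diff_distrib sum_negf mult_ac)
  finally show ?thesis by (simp add: y_def)
qed

text \<open>
  By the quotient rule, the row of \<open>y\<^sub>i / g\<^sub>k\<^sub>+\<^sub>1\<close> is \<open>- \<alpha>\<^sub>i / \<beta>\<close> times the last row, plus \<open>1 / \<beta>\<close> in column \<open>i\<close>.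
\<close>

lemma moment_g_has_derivative:
  fixes \<alpha> :: "real^'k::finite"
  assumes "\<forall>i. 0 < \<alpha> $ i" "0 < \<beta>"
  shows "(moment_g has_derivative (\<lambda>u. moment_G \<alpha> \<beta> *v u)) (at (gamma_moments (mgamma_param \<alpha> \<beta>)))"
proof -
  define y where "y = gamma_moments (mgamma_param \<alpha> \<beta>)"
  note scale = moment_g_scale_has_derivative[OF assms, folded y_def]
  have "mgamma_param \<alpha> \<beta> \<in> mgamma_params"
    using assms by (auto simp: mgamma_params_def mgamma_param_def split: sum.split)
  then have s: "moment_g_scale y = \<beta>"
    unfolding y_def by (subst moment_g_scale_gamma_moments) (auto simp: mgamma_param_def)
  have y: "y $ Inl i = \<alpha> $ i * \<beta>" for i
    by (simp add: y_def mgamma_param_def)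
  have nz: "\<alpha> $ j \<noteq> 0" "\<beta> \<noteq> 0" for j using assms by (simp_all add: less_imp_neq[symmetric])
  have nth: "((\<lambda>y. y $ c) has_derivative (\<lambda>u. u $ c)) (at y)" for c
    by (rule bounded_linear_imp_has_derivative[OF bounded_linear_vec_nth])
  have "((\<lambda>y. moment_g y $ c) has_derivative (\<lambda>u. (moment_G \<alpha> \<beta> *v u) $ c)) (at y)" for c
  proof (cases c)
    case (Inr r)
    then have "c = Inr 1" by simp
    then show ?thesis using scale by (simp add: moment_g_def)
  next
    case (Inl i)
    have "((\<lambda>y. y $ Inl i / moment_g_scale y) has_derivative
        (\<lambda>u. u $ Inl i / \<beta> - \<alpha> $ i / \<beta> * (moment_G \<alpha> \<beta> *v u) $ Inr 1)) (at y)"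
      by (rule has_derivative_eq_rhs[OF has_derivative_divide[OF nth scale]])
         (use nz s y in \<open>auto simp: fun_eq_iff field_simps\<close>)
    also have "(\<lambda>u. u $ Inl i / \<beta> - \<alpha> $ i / \<beta> * (moment_G \<alpha> \<beta> *v u) $ Inr 1) = (\<lambda>u. (moment_G \<alpha> \<beta> *v u) $ Inl i)"
    proof
      fix u :: "real^('k + 'k)"
      have rows: "moment_G \<alpha> \<beta> $ Inl i $ Inl j = - (\<alpha> $ i / \<beta>) * moment_G \<alpha> \<beta> $ Inr 1 $ Inl j + (if i = j then 1 / \<beta> else 0)"
        "moment_G \<alpha> \<beta> $ Inl i $ Inr j = - (\<alpha> $ i / \<beta>) * moment_G \<alpha> \<beta> $ Inr 1 $ Inr j" for j
        by (simp_all add: moment_G_def Let_def power2_eq_square mult_ac)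
      show "u $ Inl i / \<beta> - \<alpha> $ i / \<beta> * (moment_G \<alpha> \<beta> *v u) $ Inr 1 = (moment_G \<alpha> \<beta> *v u) $ Inl i"
        by (simp add: matrix_vector_mult_def sum_UNIV_sum_type rows distrib_left left_diff_distrib sum_subtractf
            sum_distrib_left sum_negf if_distrib[where f="\<lambda>z. z * w" for w] mult.assoc cong: if_cong)
    qed
    finally show ?thesis by (simp add: Inl moment_g_def)
  qed
  then show ?thesis
    unfolding y_def[symmetric] has_derivative_componentwise_within[of moment_g]
    by (auto simp: Basis_vec_def inner_axis)
qed

lemma open_mgamma_params: "open (mgamma_params :: (real^('k::finite + 1)) set)"
proof -
  have "mgamma_params = (\<Inter>i. {\<theta> :: real^('k + 1). 0 < \<theta> $ i})"
    by (auto simp: mgamma_params_def)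
  also have "open \<dots>" by (intro open_INT ballI open_Collect_less continuous_intros) simp
  finally show ?thesis .
qed

theorem proposition4p6:
  fixes \<alpha> :: "real^'k::{finite,wellorder}" and \<beta> :: real
    and M :: "'a measure" and X :: "nat \<Rightarrow> 'a \<Rightarrow> real^'k::_"
  assumes "\<forall>i. 0 < \<alpha> $ i" and "0 < \<beta>"
    and "prob_space M" and "random_sample M X (mgamma \<alpha> \<beta>)"
  shows "moment_type_estimator (mgamma_family :: real^('k + 1) \<Rightarrow> (real^'k::_) measure)
           mgamma_params moment_h moment_g moment_estimator
       \<and> has_asymptotic_covariance M mgamma_params (mgamma_param \<alpha> \<beta>)
           (\<lambda>N \<omega>. moment_estimator N (\<lambda>n. X n \<omega>))
           (moment_G \<alpha> \<beta> ** covariance_of mgamma_family moment_h (mgamma_param \<alpha> \<beta>)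
              ** transpose (moment_G \<alpha> \<beta>))"
proof
  let ?\<Theta> = "mgamma_params :: (real^('k + 1)) set" and ?\<theta> = "mgamma_param \<alpha> \<beta>"
  have inverse: "moment_g (mean_of mgamma_family moment_h \<theta>) = \<theta>" if "\<theta> \<in> ?\<Theta>" for \<theta>
    using that by (simp add: mgamma_family_moments(3) moment_g_gamma_moments)
  have inj: "inj_on (mean_of mgamma_family moment_h) ?\<Theta>"
    by (rule inj_on_inverseI) (rule inverse)
  show "moment_type_estimator mgamma_family ?\<Theta> moment_h moment_g moment_estimator"
    unfolding moment_type_estimator_def
    using inj by (auto simp: mgamma_family_moments(1) inverse the_inv_into_f_f moment_estimator_eq_g)
  have \<theta>: "?\<theta> \<in> ?\<Theta>"
    using assms(1,2) by (auto simp: mgamma_params_def mgamma_param_def split: sum.split)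
  have family: "mgamma_family ?\<theta> = mgamma \<alpha> \<beta>"
    by (simp add: mgamma_family_def mgamma_param_def)
  show "has_asymptotic_covariance M ?\<Theta> ?\<theta> (\<lambda>N \<omega>. moment_estimator N (\<lambda>n. X n \<omega>))
     (moment_G \<alpha> \<beta> ** covariance_of mgamma_family moment_h ?\<theta> ** transpose (moment_G \<alpha> \<beta>))"
    using moment_g_has_derivative[OF assms(1,2)]
    by (intro moment_estimator_asymptotic_covariance[where h=moment_h and g=moment_g])
       (simp_all add: assms(3,4) family moment_g_gamma_moments[OF \<theta>] moment_h_measurable moment_g_measurable \<theta>
          open_mgamma_params mgamma_family_moments moment_estimator_eq_g mgamma_family_moments(2)[OF \<theta>, unfolded family])
qed

end
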